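(* Let $A$ be a uniform algebra on a compact Hausdorff space $\Omega$, let $E\subset\Omega$ be a peak set for $A$, and let $f\in\mathcal{R}_E(\Omega)$. Let $D$ be the unique peak set for $A$ in $M_A$ with $D\cap\Omega=E$. Then there is a unique function $\tilde f\in\mathcal{R}_D(M_A)$ such that $\tilde f$ restricted to $\Omega$ equals $f$. Also, $\|af\|_\Omega=\|a\tilde f\|_{M_A}$ for all $a\in A$, so that $\overline{Af}$ in $C(\Omega)$ is $A$-isometric to $\overline{A\tilde f}$ in $C(M_A)$.
   Context: A uniform algebra on a compact Hausdorff space $\Omega$ is a closed subalgebra of $C(\Omega)$ (complex continuous functions) which contains the constants and separates points. $M_A$ is the maximal ideal space of $A$; $\Omega$ is regarded as a subset of $M_A$ via point evaluations, and $A$ is regarded as a uniform algebra on $M_A$ via the Gelfand transform. A peak set for $A$ in $\Omega$ is a set of the form $\{w\in\Omega:a(w)=1\}$ for some $a\in A$ with $|a(w)|<1$ for all other $w\in\Omega$ (the empty set is allowed); every peak set in $\Omega$ is $D\cap\Omega$ for a unique peak set $D$ in $M_A$. $\|\cdot\|_\Omega$ denotes the sup norm over $\Omega$; $A$-isometric means isomorphic via a surjective isometric $A$-module map. An $A$-tuple is an element of $A^{(n)}$ for some $n$, regarded as a function into $\mathbb{C}^n$; $H\cdot K=\sum_ih_ik_i$ for $A$-tuples of equal length, and $\|\cdot\|_2$ is the Euclidean norm. For a compact space $\Omega$ on which $A$ is a uniform algebra and a closed subset $E\subset\Omega$, $\mathcal{R}_E(\Omega)$ is the set of $f\in C(\Omega)$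 which vanish exactly on $E$ and for which there are two sequences $H_n,K_n$ of $A$-tuples ($H_n$, $K_n$ of the same length) such that (i) $\|K_n(w)\|_2\le f(w)\le\|H_n(w)\|_2^{-1}$ for all $w\in\Omega$ (with $\frac10=\infty$), and (ii) $H_n(w)\cdot K_n(w)\to1$ uniformly on compact subsets of $\Omega\setminus E$. *)

theory Defs
  imports "HOL-Analysis.Analysis"
begin

(* Spaces are abstract topologies, because the maximal ideal space depends on the algebra and
   so cannot be a type. C(X) is the library's metric space of bounded continuous functions
   with the sup distance; its elements are extensional on topspace X, which is why the
   pointwise operations below are restricted to topspace X. *)

abbreviation C_space :: "'x topology \<Rightarrow> ('x \<Rightarrow> complex) metric" where
  "C_space X \<equiv> cfunspace X (euclidean_metric :: complex metric)"

definition fconst :: "'x topology \<Rightarrow> complex \<Rightarrow> 'x \<Rightarrow> complex" where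
  "fconst X c = (\<lambda>x\<in>topspace X. c)"

definition fadd :: "'x topology \<Rightarrow> ('x \<Rightarrow> complex) \<Rightarrow> ('x \<Rightarrow> complex) \<Rightarrow> 'x \<Rightarrow> complex" where
  "fadd X f g = (\<lambda>x\<in>topspace X. f x + g x)"

definition fmult :: "'x topology \<Rightarrow> ('x \<Rightarrow> complex) \<Rightarrow> ('x \<Rightarrow> complex) \<Rightarrow> 'x \<Rightarrow> complex" where
  "fmult X f g = (\<lambda>x\<in>topspace X. f x * g x)"

definition sup_norm :: "'x topology \<Rightarrow> ('x \<Rightarrow> complex) \<Rightarrow> real" where
  "sup_norm X f = (if topspace X = {} then 0 else (SUP x\<in>topspace X. cmod (f x)))"

(* Closure under scalar multiplication follows from constants and products. *)
definition uniform_algebra :: "'x topology \<Rightarrow> ('x \<Rightarrow> complex) set \<Rightarrow> bool" where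
  "uniform_algebra X A \<longleftrightarrow>
     compact_space X \<and> Hausdorff_space X \<and>
     A \<subseteq> mspace (C_space X) \<and>
     closedin (mtopology_of (C_space X)) A \<and>
     (\<forall>c. fconst X c \<in> A) \<and>
     (\<forall>f\<in>A. \<forall>g\<in>A. fadd X f g \<in> A) \<and>
     (\<forall>f\<in>A. \<forall>g\<in>A. fmult X f g \<in> A) \<and>
     (\<forall>x\<in>topspace X. \<forall>y\<in>topspace X. x \<noteq> y \<longrightarrow> (\<exists>f\<in>A. f x \<noteq> f y))"

(* The maximal ideal space is taken in its standard form, as the space of nonzero (equivalently
   unital) multiplicative linear functionals on A with the topology of pointwise convergence
   on A. Functionals are extensional on A, as required by product_topology. *)
definition characters ::
    "'x topology \<Rightarrow> ('x \<Rightarrow> complex) set \<Rightarrow> (('x \<Rightarrow> complex) \<Rightarrow> complex) set" where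
  "characters X A = {\<phi> \<in> extensional A.
     \<phi> (fconst X 1) = 1 \<and>
     (\<forall>f\<in>A. \<forall>g\<in>A. \<phi> (fadd X f g) = \<phi> f + \<phi> g) \<and>
     (\<forall>c. \<forall>f\<in>A. \<phi> (fmult X (fconst X c) f) = c * \<phi> f) \<and>
     (\<forall>f\<in>A. \<forall>g\<in>A. \<phi> (fmult X f g) = \<phi> f * \<phi> g)}"

definition max_ideal_space ::
    "'x topology \<Rightarrow> ('x \<Rightarrow> complex) set \<Rightarrow> (('x \<Rightarrow> complex) \<Rightarrow> complex) topology" where
  "max_ideal_space X A =
     subtopology (product_topology (\<lambda>_. (euclidean :: complex topology)) A) (characters X A)"

definition gelfand ::
    "'x topology \<Rightarrow> ('x \<Rightarrow> complex) set \<Rightarrow> ('x \<Rightarrow> complex) \<Rightarrow> (('x \<Rightarrow> complex) \<Rightarrow> complex) \<Rightarrow> complex" where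
  "gelfand X A a = (\<lambda>\<phi>\<in>topspace (max_ideal_space X A). \<phi> a)"

definition pt_eval :: "('x \<Rightarrow> complex) set \<Rightarrow> 'x \<Rightarrow> ('x \<Rightarrow> complex) \<Rightarrow> complex" where
  "pt_eval A w = (\<lambda>a\<in>A. a w)"

definition peak_set :: "'x topology \<Rightarrow> ('x \<Rightarrow> complex) set \<Rightarrow> 'x set \<Rightarrow> bool" where
  "peak_set X A E \<longleftrightarrow>
     (\<exists>a\<in>A. E = {w \<in> topspace X. a w = 1} \<and> (\<forall>w \<in> topspace X - E. cmod (a w) < 1))"

(* Tuples of functions are lists. *)
definition tuple_norm :: "('x \<Rightarrow> complex) list \<Rightarrow> 'x \<Rightarrow> real" where
  "tuple_norm hs w = L2_set (\<lambda>i. cmod ((hs ! i) w)) {..<length hs}"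

definition tuple_dot :: "('x \<Rightarrow> complex) list \<Rightarrow> ('x \<Rightarrow> complex) list \<Rightarrow> 'x \<Rightarrow> complex" where
  "tuple_dot hs ks w = (\<Sum>i<length hs. (hs ! i) w * (ks ! i) w)"

(* The set R_E(X). Members are complex-valued elements of C(X); condition (i) makes them real
   and nonnegative. The inverse is taken in ereal, where the inverse of 0 is infinity. *)
definition R_class ::
    "'x topology \<Rightarrow> ('x \<Rightarrow> complex) set \<Rightarrow> 'x set \<Rightarrow> ('x \<Rightarrow> complex) set" where
  "R_class X A E = {f \<in> mspace (C_space X).
     {w \<in> topspace X. f w = 0} = E \<and>
     (\<exists>H K :: nat \<Rightarrow> ('x \<Rightarrow> complex) list.
        (\<forall>n. set (H n) \<subseteq> A \<and> set (K n) \<subseteq> A \<and> length (H n) = length (K n)) \<and>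
        (\<forall>n. \<forall>w\<in>topspace X. f w \<in> \<real> \<and>
           tuple_norm (K n) w \<le> Re (f w) \<and>
           ereal (Re (f w)) \<le> inverse (ereal (tuple_norm (H n) w))) \<and>
        (\<forall>S. compactin X S \<and> S \<subseteq> topspace X - E \<longrightarrow>
           uniform_limit S (\<lambda>n w. tuple_dot (H n) (K n) w) (\<lambda>_. 1) sequentially))}"

(* The closure of A f in C(Y), where a in A acts on C(Y) as multiplication by \<rho> a. *)
definition cyclic_module ::
    "'y topology \<Rightarrow> 'r set \<Rightarrow> ('r \<Rightarrow> 'y \<Rightarrow> complex) \<Rightarrow> ('y \<Rightarrow> complex) \<Rightarrow> ('y \<Rightarrow> complex) set" where
  "cyclic_module Y A \<rho> f = mtopology_of (C_space Y) closure_of ((\<lambda>a. fmult Y (\<rho> a) f) ` A)"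

(* M in C(X) and N in C(Y) are A-modules, a in A acting as multiplication by \<rho> a on M and by
   \<sigma> a on N. Complex linearity is the action of the constants in A. *)
definition A_isometric ::
    "'r set \<Rightarrow> 'x topology \<Rightarrow> ('r \<Rightarrow> 'x \<Rightarrow> complex) \<Rightarrow> ('x \<Rightarrow> complex) set \<Rightarrow>
     'y topology \<Rightarrow> ('r \<Rightarrow> 'y \<Rightarrow> complex) \<Rightarrow> ('y \<Rightarrow> complex) set \<Rightarrow> bool" where
  "A_isometric A X \<rho> M Y \<sigma> N \<longleftrightarrow>
     (\<exists>T. T ` M = N \<and>
        (\<forall>x\<in>M. \<forall>y\<in>M. T (fadd X x y) = fadd Y (T x) (T y)) \<and>
        (\<forall>a\<in>A. \<forall>x\<in>M. T (fmult X (\<rho> a) x) = fmult Y (\<sigma> a) (T x)) \<and>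
        (\<forall>x\<in>M. sup_norm Y (T x) = sup_norm X x))"

end

theory Submission
  imports Defs
begin

text \<open>
  Let \<open>H n\<close>, \<open>K n\<close> be tuples witnessing \<open>f \<in> R_E(\<Omega>)\<close>. Every character satisfies
  \<open>\<bar>\<phi>(a)\<bar> \<le> \<parallel>a\<parallel>\<close>, and \<open>\<parallel>K(\<phi>)\<parallel>\<^sub>2\<close> is the value of \<open>\<phi>\<close> at some \<open>b \<in> A\<close> with
  \<open>\<bar>b\<bar> \<le> \<parallel>K\<parallel>\<^sub>2\<close> on \<open>\<Omega>\<close>. Hence inequalities such as
  \<open>\<parallel>H m\<parallel>\<^sub>2 \<parallel>K n\<parallel>\<^sub>2 \<le> 1\<close> and \<open>\<bar>a\<bar> \<parallel>K n\<parallel>\<^sub>2 \<le> C\<close> pass from \<open>\<Omega>\<close> to the maximal ideal space. The extension is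
  the supremum of the \<open>\<parallel>K n\<parallel>\<^sub>2\<close>. If \<open>q\<close> is a peak function, then \<open>(1 - q)(H n \<cdot> K n - 1)\<close> tends to 0
  uniformly on \<open>\<Omega>\<close>, hence on the maximal ideal space, which gives convergence off the peak set;
  \<open>\<parallel>q\<^sup>j f\<parallel> \<rightarrow> 0\<close> controls the behaviour near it. Uniqueness and the isometry follow by applying
  the same transferred inequalities to the tuples of an arbitrary extension.
\<close>

section \<open>Closures and pullbacks in spaces of continuous functions\<close>

lemma mem_C_space_iff:
  "f \<in> mspace (C_space X) \<longleftrightarrow> continuous_map X euclidean f \<and> f \<in> extensional (topspace X) \<and>
     (\<exists>B. \<forall>x\<in>topspace X. cmod (f x) \<le> B)"
proof -
  have "Met_TC.mbounded (f ` topspace X) \<longleftrightarrow> (\<exists>B. \<forall>x\<in>topspace X. cmod (f x) \<le> B)"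
    by (auto simp: bounded_iff)
  then show ?thesis
    by (auto simp: Metric_space.fspace_def)
qed

text \<open>Continuity and boundedness of \<open>g\<close> are not demanded on the right because
  both pass to uniform limits. This turns every later closure argument into an
  \<open>e\<close>-estimate.\<close>

lemma C_closure_iff:
  assumes S: "S \<subseteq> mspace (C_space X)"
  shows "g \<in> mtopology_of (C_space X) closure_of S \<longleftrightarrow>
     g \<in> extensional (topspace X) \<and>
     (\<forall>e>0. \<exists>s\<in>S. \<forall>x\<in>topspace X. cmod (s x - g x) \<le> e)" (is "?l = ?r")
proof
  assume ?l
  then have g: "g \<in> mspace (C_space X)"
    and *: "\<And>r. r > 0 \<Longrightarrow> \<exists>y\<in>S. mdist (C_space X) g y \<le> r"
    unfolding mtopology_of_def Metric_space.metric_closure_of_alt[OF Metric_space_mspace_mdist]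
    by (auto simp: Metric_space.in_mcball[OF Metric_space_mspace_mdist] simp del: mspace_cfunspace)
  have "\<exists>s\<in>S. \<forall>x\<in>topspace X. cmod (s x - g x) \<le> e" if e: "e > 0" for e
  proof -
    obtain s where s: "s \<in> S" "mdist (C_space X) g s \<le> e"
      using *[OF e] by blast
    then have "\<forall>x\<in>topspace X. dist (g x) (s x) \<le> e"
      using mdist_cfunspace_imp_mdist_le[OF g subsetD[OF S s(1)]] by simp
    with s show ?thesis
      by (intro bexI[of _ s]) (auto simp: dist_norm norm_minus_commute)
  qed
  with g show ?r
    by (auto simp: mem_C_space_iff)
next
  assume r: ?r
  have "\<forall>n::nat. \<exists>s\<in>S. \<forall>x\<in>topspace X. cmod (s x - g x) \<le> inverse (Suc n)"
    using r by auto
  then obtain s where s: "\<And>n. s n \<in> S"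
    and sg: "\<And>n x. x \<in> topspace X \<Longrightarrow> cmod (s n x - g x) \<le> inverse (Suc n)"
    by metis
  have "continuous_map X Met_TC.mtopology g"
  proof (rule Met_TC.continuous_map_uniform_limit_alt)
    show "\<forall>\<^sub>F n in sequentially. continuous_map X Met_TC.mtopology (s n)"
      using s S by (intro always_eventually) auto
    show "\<forall>\<^sub>F n in sequentially. \<forall>x\<in>topspace X. dist (s n x) (g x) < e" if "0 < e" for e
      using order_tendstoD(2)[OF LIMSEQ_inverse_real_of_nat that]
      by eventually_elim (auto simp: dist_norm intro: le_less_trans[OF sg])
  qed auto
  moreover have "\<exists>B. \<forall>x\<in>topspace X. cmod (g x) \<le> B"
  proof -
    \<comment> \<open>Since \<open>inverse (Suc 0) = 1\<close>, the function \<open>g\<close> stays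
      within 1 of the bounded function \<open>s 0\<close>.\<close>
    obtain B where "\<forall>x\<in>topspace X. cmod (s 0 x) \<le> B"
      using subsetD[OF S s, of 0] unfolding mem_C_space_iff by blast
    moreover have "cmod (g x) \<le> cmod (s 0 x) + 1" if "x \<in> topspace X" for x
      using sg[OF that, of 0] norm_triangle_ineq3[of "s 0 x" "g x"] by simp
    ultimately show ?thesis
      by (intro exI[of _ "B + 1"]) fastforce
  qed
  ultimately have g: "g \<in> mspace (C_space X)"
    using r unfolding mem_C_space_iff by simp
  have "\<exists>y\<in>S. g \<in> mspace (C_space X) \<and> y \<in> mspace (C_space X) \<and> mdist (C_space X) g y \<le> e"
    if e: "e > 0" for e
  proof -
    obtain t where t: "t \<in> S" "\<forall>x\<in>topspace X. cmod (t x - g x) \<le> e"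
      using r e by blast
    have "mdist (C_space X) g t \<le> e"
      using t e by (intro mdist_cfunspace_le) (auto simp: dist_norm norm_minus_commute)
    then show ?thesis
      using t g S by blast
  qed
  with g show ?l
    unfolding mtopology_of_def Metric_space.metric_closure_of_alt[OF Metric_space_mspace_mdist]
    by (simp add: Metric_space.in_mcball[OF Metric_space_mspace_mdist] del: mspace_cfunspace)
qed

lemma C_closure_subset:
  "S \<subseteq> mspace (C_space X) \<Longrightarrow> mtopology_of (C_space X) closure_of S \<subseteq> mspace (C_space X)"
  by (metis closure_of_subset_topspace topspace_mtopology_of)

lemma continuous_map_complex_mult:
  fixes f g :: "'a \<Rightarrow> complex"
  shows "continuous_map X euclidean f \<Longrightarrow> continuous_map X euclidean g \<Longrightarrow>
    continuous_map X euclidean (\<lambda>x. f x * g x)"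
  by (simp add: continuous_map_atin tendsto_mult)

lemma fmult_in_C_space:
  "f \<in> mspace (C_space X) \<Longrightarrow> g \<in> mspace (C_space X) \<Longrightarrow> fmult X f g \<in> mspace (C_space X)"
  unfolding mem_C_space_iff fmult_def
proof (safe, goal_cases)
  case (1 B C)
  then show ?case
    by (auto intro: continuous_map_eq[OF continuous_map_complex_mult])
next
  case (3 B C)
  show ?case
  proof (intro exI ballI)
    fix x assume x: "x \<in> topspace X"
    then have "cmod (f x) * cmod (g x) \<le> B * C"
      using 3 by (intro mult_mono) (auto intro: order_trans[OF norm_ge_zero])
    with x show "cmod ((\<lambda>x\<in>topspace X. f x * g x) x) \<le> B * C"
      by (simp add: norm_mult)
  qed
qed auto

lemma sup_norm_le:
  assumes "C \<ge> 0" "\<And>x. x \<in> topspace X \<Longrightarrow> cmod (f x) \<le> C"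
  shows "sup_norm X f \<le> C"
  using assms by (auto simp: sup_norm_def intro!: cSUP_least)

lemma norm_le_sup_norm:
  assumes "f \<in> mspace (C_space X)" "x \<in> topspace X"
  shows "cmod (f x) \<le> sup_norm X f"
proof -
  have "bdd_above ((\<lambda>x. cmod (f x)) ` topspace X)"
    using assms unfolding mem_C_space_iff by (auto intro: bdd_aboveI2)
  then show ?thesis
    using assms(2) by (auto simp: sup_norm_def intro: cSUP_upper)
qed

lemma sup_norm_nonneg:
  assumes "f \<in> mspace (C_space X)"
  shows "sup_norm X f \<ge> 0"
proof (cases "topspace X = {}")
  case False
  then obtain x where "x \<in> topspace X" by blast
  from norm_le_sup_norm[OF assms this] norm_ge_zero[of "f x"] show ?thesis by linarith
qed (simp add: sup_norm_def)

text \<open>Two sup norms agree once they have the same nonnegative upper bounds. This fits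
  estimates that transfer from one space to another one constant at a time, and it covers empty
  spaces.\<close>

lemma sup_norm_eqI:
  assumes "f \<in> mspace (C_space X)" "g \<in> mspace (C_space Y)"
    and "\<And>e. e \<ge> 0 \<Longrightarrow> (\<forall>x\<in>topspace X. cmod (f x) \<le> e) \<longleftrightarrow> (\<forall>y\<in>topspace Y. cmod (g y) \<le> e)"
  shows "sup_norm X f = sup_norm Y g"
proof (rule antisym)
  show "sup_norm X f \<le> sup_norm Y g"
    using assms(3)[OF sup_norm_nonneg[OF assms(2)]] norm_le_sup_norm[OF assms(2)]
    by (intro sup_norm_le sup_norm_nonneg assms) auto
  show "sup_norm Y g \<le> sup_norm X f"
    using assms(3)[OF sup_norm_nonneg[OF assms(1)]] norm_le_sup_norm[OF assms(1)]
    by (intro sup_norm_le sup_norm_nonneg assms) auto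
qed

lemma C_closure_fadd:
  assumes S: "S \<subseteq> mspace (C_space X)" and add: "\<And>s t. s \<in> S \<Longrightarrow> t \<in> S \<Longrightarrow> fadd X s t \<in> S"
    and f: "f \<in> mtopology_of (C_space X) closure_of S"
    and g: "g \<in> mtopology_of (C_space X) closure_of S"
  shows "fadd X f g \<in> mtopology_of (C_space X) closure_of S"
  unfolding C_closure_iff[OF S]
proof safe
  show "fadd X f g \<in> extensional (topspace X)"
    by (simp add: fadd_def)
  fix e :: real assume "e > 0"
  then obtain s t where st: "s \<in> S" "t \<in> S" "\<forall>x\<in>topspace X. cmod (s x - f x) \<le> e/2"
      "\<forall>x\<in>topspace X. cmod (t x - g x) \<le> e/2"
    using f g unfolding C_closure_iff[OF S] by (meson half_gt_zero)
  show "\<exists>r\<in>S. \<forall>x\<in>topspace X. cmod (r x - fadd X f g x) \<le> e"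
  proof (intro bexI ballI)
    fix x assume x: "x \<in> topspace X"
    have "cmod ((s x - f x) + (t x - g x)) \<le> e/2 + e/2"
      using st x by (intro norm_triangle_le add_mono) auto
    then show "cmod (fadd X s t x - fadd X f g x) \<le> e"
      using x by (simp add: fadd_def algebra_simps)
  qed (use st add in auto)
qed

lemma C_closure_fmult:
  assumes S: "S \<subseteq> mspace (C_space X)" and mult: "\<And>s. s \<in> S \<Longrightarrow> fmult X a s \<in> S"
    and a: "a \<in> mspace (C_space X)"
    and f: "f \<in> mtopology_of (C_space X) closure_of S"
  shows "fmult X a f \<in> mtopology_of (C_space X) closure_of S"
  unfolding C_closure_iff[OF S]
proof safe
  show "fmult X a f \<in> extensional (topspace X)"
    by (simp add: fmult_def)
  fix e :: real assume e: "e > 0"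
  \<comment> \<open>The summand 1 makes \<open>B\<close> positive, so that \<open>e/B\<close> is a
    legitimate tolerance even for \<open>a = 0\<close>.\<close>
  define B where "B = sup_norm X a + 1"
  have B: "B > 0"
    using sup_norm_nonneg[OF a] by (simp add: B_def)
  have aB: "cmod (a x) \<le> B" if "x \<in> topspace X" for x
    using norm_le_sup_norm[OF a that] by (simp add: B_def)
  obtain s where s: "s \<in> S" "\<forall>x\<in>topspace X. cmod (s x - f x) \<le> e/B"
    using f e B unfolding C_closure_iff[OF S] by (meson divide_pos_pos)
  show "\<exists>r\<in>S. \<forall>x\<in>topspace X. cmod (r x - fmult X a f x) \<le> e"
  proof (intro bexI ballI)
    fix x assume x: "x \<in> topspace X"
    have "cmod (a x) * cmod (s x - f x) \<le> B * (e / B)"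
      using s x B aB by (intro mult_mono) auto
    then show "cmod (fmult X a s x - fmult X a f x) \<le> e"
      using x B by (simp add: fmult_def norm_mult flip: right_diff_distrib)
  qed (use s mult in auto)
qed

section \<open>Pullback along a continuous map\<close>

definition pullback :: "'x topology \<Rightarrow> ('x \<Rightarrow> 'y) \<Rightarrow> ('y \<Rightarrow> complex) \<Rightarrow> 'x \<Rightarrow> complex" where
  "pullback X j h = (\<lambda>x\<in>topspace X. h (j x))"

lemma pullback_in_C_space:
  assumes "continuous_map X Y j" "h \<in> mspace (C_space Y)"
  shows "pullback X j h \<in> mspace (C_space X)"
proof -
  have j: "j x \<in> topspace Y" if "x \<in> topspace X" for x
    using that assms(1) by (auto simp: continuous_map_def)
  have "continuous_map X euclidean (h \<circ> j)"
    using assms unfolding mem_C_space_iff by (blast intro: continuous_map_compose)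
  then have "continuous_map X euclidean (pullback X j h)"
    by (rule continuous_map_eq) (simp add: pullback_def)
  moreover obtain B where "\<forall>y\<in>topspace Y. cmod (h y) \<le> B"
    using assms(2) unfolding mem_C_space_iff by blast
  ultimately show ?thesis
    unfolding mem_C_space_iff using j by (auto simp: pullback_def)
qed

lemma pullback_fadd:
  "continuous_map X Y j \<Longrightarrow> pullback X j (fadd Y f g) = fadd X (pullback X j f) (pullback X j g)"
  by (rule ext) (auto simp: pullback_def fadd_def continuous_map_def Pi_iff)

lemma pullback_fmult:
  "continuous_map X Y j \<Longrightarrow> pullback X j (fmult Y f g) = fmult X (pullback X j f) (pullback X j g)"
  by (rule ext) (auto simp: pullback_def fmult_def continuous_map_def Pi_iff)

text \<open>The hypothesis \<open>iso\<close> says that differences of members of \<open>S\<close>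
  are bounded on all of \<open>Y\<close> by their bounds on the image of \<open>j\<close>.
  Approximating \<open>f\<close> and \<open>g\<close> from \<open>S\<close> extends this to the
  closure.\<close>

lemma pullback_closure_norm:
  assumes S: "S \<subseteq> mspace (C_space Y)" and j: "continuous_map X Y j"
    and iso: "\<And>s t e. \<lbrakk>s \<in> S; t \<in> S; \<forall>x\<in>topspace X. cmod (s (j x) - t (j x)) \<le> e; e \<ge> 0\<rbrakk>
      \<Longrightarrow> \<forall>y\<in>topspace Y. cmod (s y - t y) \<le> e"
    and f: "f \<in> mtopology_of (C_space Y) closure_of S"
    and g: "g \<in> mtopology_of (C_space Y) closure_of S"
    and le: "\<forall>x\<in>topspace X. cmod (f (j x) - g (j x)) \<le> e" and e: "e \<ge> 0"
    and y: "y \<in> topspace Y"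
  shows "cmod (f y - g y) \<le> e"
proof (rule field_le_epsilon)
  have tri: "cmod (a - b + c) \<le> cmod a + cmod b + cmod c" for a b c
    using norm_triangle_ineq[of "a - b" c] norm_triangle_ineq4[of a b] by linarith
  fix d :: real assume d: "d > 0"
  \<comment> \<open>Two approximants with error \<open>d/4\<close> cost \<open>d/2\<close> on the
    image of \<open>j\<close>, and another \<open>d/2\<close> on the way back to \<open>f\<close>
    and \<open>g\<close> at \<open>y\<close>.\<close>
  then have "d/4 > 0" by simp
  with f g obtain s t where st: "s \<in> S" "t \<in> S" and s: "\<forall>x\<in>topspace Y. cmod (s x - f x) \<le> d/4"
      and t: "\<forall>x\<in>topspace Y. cmod (t x - g x) \<le> d/4"
    unfolding C_closure_iff[OF S] by meson
  have "cmod (s (j x) - t (j x)) \<le> e + d/2" if x: "x \<in> topspace X" for x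
  proof -
    have jx: "j x \<in> topspace Y"
      using x j by (auto simp: continuous_map_def)
    show ?thesis
      using tri[of "s (j x) - f (j x)" "t (j x) - g (j x)" "f (j x) - g (j x)"]
        bspec[OF s jx] bspec[OF t jx] bspec[OF le x] by simp
  qed
  then have "cmod (s y - t y) \<le> e + d/2"
    using iso[OF st, of "e + d/2"] y e d by auto
  then show "cmod (f y - g y) \<le> e + d"
    using tri[of "t y - g y" "s y - f y" "s y - t y"] bspec[OF s y] bspec[OF t y] by simp
qed

text \<open>By \<open>iso\<close>, functions in \<open>S\<close> whose pullbacks converge uniformly
  on \<open>X\<close> are uniformly Cauchy on all of \<open>Y\<close>, and their limit is the
  required preimage. With \<open>j\<close> the point evaluation, this says that restriction to the
  original space maps one closed module onto the other.\<close>

lemma pullback_closure_image: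
  assumes S: "S \<subseteq> mspace (C_space Y)" and j: "continuous_map X Y j"
    and iso: "\<And>s t e. \<lbrakk>s \<in> S; t \<in> S; \<forall>x\<in>topspace X. cmod (s (j x) - t (j x)) \<le> e; e \<ge> 0\<rbrakk>
      \<Longrightarrow> \<forall>y\<in>topspace Y. cmod (s y - t y) \<le> e"
  shows "pullback X j ` (mtopology_of (C_space Y) closure_of S) =
    mtopology_of (C_space X) closure_of (pullback X j ` S)"
proof (intro equalityI subsetI)
  have PS: "pullback X j ` S \<subseteq> mspace (C_space X)"
    using pullback_in_C_space[OF j] S by blast
  have jx: "j x \<in> topspace Y" if "x \<in> topspace X" for x
    using that j by (auto simp: continuous_map_def)
  {
    fix h assume "h \<in> pullback X j ` (mtopology_of (C_space Y) closure_of S)"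
    then obtain g where g: "g \<in> mtopology_of (C_space Y) closure_of S" and h: "h = pullback X j g"
      by blast
    show "h \<in> mtopology_of (C_space X) closure_of (pullback X j ` S)"
      unfolding C_closure_iff[OF PS]
    proof safe
      show "h \<in> extensional (topspace X)" by (simp add: h pullback_def)
      fix e :: real assume "e > 0"
      then obtain s where "s \<in> S" "\<forall>y\<in>topspace Y. cmod (s y - g y) \<le> e"
        using g unfolding C_closure_iff[OF S] by blast
      then show "\<exists>s\<in>pullback X j ` S. \<forall>x\<in>topspace X. cmod (s x - h x) \<le> e"
        using jx by (intro bexI[of _ "pullback X j s"]) (auto simp: h pullback_def)
    qed
  next
    fix h assume "h \<in> mtopology_of (C_space X) closure_of (pullback X j ` S)"
    then have h: "h \<in> extensional (topspace X)"
      and *: "\<And>e. e > 0 \<Longrightarrow> \<exists>s\<in>S. \<forall>x\<in>topspace X. cmod (s (j x) - h x) \<le> e"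
      unfolding C_closure_iff[OF PS] by (auto simp: pullback_def)
    have "\<forall>n::nat. \<exists>s\<in>S. \<forall>x\<in>topspace X. cmod (s (j x) - h x) \<le> inverse (Suc n)"
      using * by auto
    then obtain s where s: "\<And>n. s n \<in> S"
      and sh: "\<And>n x. x \<in> topspace X \<Longrightarrow> cmod (s n (j x) - h x) \<le> inverse (Suc n)"
      by metis
    \<comment> \<open>The estimate is obvious only on the image of \<open>j\<close>;
      \<open>iso\<close> moves it to every \<open>y\<close>.\<close>
    have cau: "cmod (s m y - s n y) \<le> inverse (Suc m) + inverse (Suc n)"
      if "y \<in> topspace Y" for m n y
    proof -
      have "\<forall>x\<in>topspace X. cmod (s m (j x) - s n (j x)) \<le> inverse (Suc m) + inverse (Suc n)"
      proof
        fix x assume x: "x \<in> topspace X"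
        have "cmod ((s m (j x) - h x) - (s n (j x) - h x)) \<le> inverse (Suc m) + inverse (Suc n)"
          by (intro norm_triangle_le_diff add_mono sh x)
        then show "cmod (s m (j x) - s n (j x)) \<le> inverse (Suc m) + inverse (Suc n)" by simp
      qed
      from iso[OF s s this] that show ?thesis by auto
    qed
    define g where "g = (\<lambda>y\<in>topspace Y. lim (\<lambda>n. s n y))"
    have lim: "(\<lambda>n. s n y) \<longlonglongrightarrow> g y" if y: "y \<in> topspace Y" for y
    proof -
      have "Cauchy (\<lambda>n. s n y)"
      proof (rule metric_CauchyI)
        fix e :: real assume e: "e > 0"
        then obtain N where N: "inverse (Suc N) < e/2"
          using reals_Archimedean half_gt_zero by blast
        show "\<exists>M. \<forall>m\<ge>M. \<forall>n\<ge>M. dist (s m y) (s n y) < e"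
        proof (intro exI allI impI)
          fix m n assume "N \<le> m" "N \<le> n"
          then have "inverse (real (Suc m)) \<le> inverse (Suc N)" "inverse (real (Suc n)) \<le> inverse (Suc N)"
            by (auto simp: field_simps)
          with cau[OF y, of m n] N show "dist (s m y) (s n y) < e"
            unfolding dist_norm by linarith
        qed
      qed
      then show ?thesis
        using y by (simp add: g_def Cauchy_convergent_iff convergent_LIMSEQ_iff)
    qed
    have sg: "cmod (s m y - g y) \<le> inverse (Suc m)" if y: "y \<in> topspace Y" for m y
    proof (rule LIMSEQ_le)
      show "(\<lambda>n. cmod (s m y - s n y)) \<longlonglongrightarrow> cmod (s m y - g y)"
        by (intro tendsto_intros lim y)
      show "(\<lambda>n. inverse (Suc m) + inverse (Suc n)) \<longlonglongrightarrow> inverse (Suc m)"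
        using tendsto_add[OF tendsto_const LIMSEQ_inverse_real_of_nat] by simp
    qed (use cau[OF y] in auto)
    have "g \<in> mtopology_of (C_space Y) closure_of S"
      unfolding C_closure_iff[OF S]
    proof safe
      show "g \<in> extensional (topspace Y)" by (simp add: g_def)
      fix e :: real assume e: "e > 0"
      then obtain N where N: "inverse (Suc N) < e"
        using reals_Archimedean by blast
      then show "\<exists>s\<in>S. \<forall>x\<in>topspace Y. cmod (s x - g x) \<le> e"
        using sg[of _ N] s[of N] by (meson less_imp_le order_trans)
    qed
    moreover have "h = pullback X j g"
    proof (rule extensionalityI[OF h])
      show "pullback X j g \<in> extensional (topspace X)" by (simp add: pullback_def)
      fix x assume x: "x \<in> topspace X"
      have "(\<lambda>n. s n (j x) - h x) \<longlonglongrightarrow> 0"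
        by (rule Lim_null_comparison[OF always_eventually LIMSEQ_inverse_real_of_nat])
          (use sh x in auto)
      then have "(\<lambda>n. s n (j x)) \<longlonglongrightarrow> h x"
        by (simp add: LIM_zero_iff)
      with lim[OF jx[OF x]] have "h x = g (j x)"
        by (rule LIMSEQ_unique[symmetric])
      then show "h x = pullback X j g x"
        using x by (simp add: pullback_def)
    qed
    ultimately show "h \<in> pullback X j ` (mtopology_of (C_space Y) closure_of S)"
      by blast
  }
qed

section \<open>Characters and tuples\<close>

text \<open>At \<open>t = 0\<close> the inverse is infinite and the product is 0, so both sides
  hold. The product form is the one that can be transferred to characters.\<close>

lemma ereal_le_inverse_iff:
  fixes r t :: real
  assumes "t \<ge> 0"
  shows "ereal r \<le> inverse (ereal t) \<longleftrightarrow> r * t \<le> 1"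
  using assms by (cases "t = 0") (auto simp: field_simps)

lemma tuple_norm_nonneg [simp]: "tuple_norm hs w \<ge> 0"
  by (simp add: tuple_norm_def)

lemma norm_tuple_dot_le:
  assumes "length hs = length ks"
  shows "cmod (tuple_dot hs ks w) \<le> tuple_norm hs w * tuple_norm ks w"
proof -
  have "cmod (tuple_dot hs ks w) \<le> (\<Sum>i<length hs. cmod ((hs ! i) w) * cmod ((ks ! i) w))"
    unfolding tuple_dot_def by (rule order_trans[OF norm_sum]) (simp add: norm_mult)
  also have "\<dots> \<le> tuple_norm hs w * tuple_norm ks w"
    using L2_set_mult_ineq[of "\<lambda>i. cmod ((hs ! i) w)" "\<lambda>i. cmod ((ks ! i) w)" "{..<length hs}"]
      assms by (simp add: tuple_norm_def)
  finally show ?thesis .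
qed

section \<open>Tuple sequences witnessing membership in the class\<close>

definition R_witness ::
  "'x topology \<Rightarrow> ('x \<Rightarrow> complex) set \<Rightarrow> 'x set \<Rightarrow> ('x \<Rightarrow> complex) \<Rightarrow>
    (nat \<Rightarrow> ('x \<Rightarrow> complex) list) \<Rightarrow> (nat \<Rightarrow> ('x \<Rightarrow> complex) list) \<Rightarrow> bool" where
  "R_witness X A E f H K \<longleftrightarrow>
    (\<forall>n. set (H n) \<subseteq> A \<and> set (K n) \<subseteq> A \<and> length (H n) = length (K n)) \<and>
    (\<forall>n. \<forall>w\<in>topspace X. f w \<in> \<real> \<and> tuple_norm (K n) w \<le> Re (f w) \<and>
      Re (f w) * tuple_norm (H n) w \<le> 1) \<and>
    (\<forall>S. compactin X S \<and> S \<subseteq> topspace X - E \<longrightarrow>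
      uniform_limit S (\<lambda>n w. tuple_dot (H n) (K n) w) (\<lambda>_. 1) sequentially)"

lemma R_class_iff:
  "f \<in> R_class X A E \<longleftrightarrow> f \<in> mspace (C_space X) \<and> {w \<in> topspace X. f w = 0} = E \<and>
    (\<exists>H K. R_witness X A E f H K)"
  unfolding R_class_def R_witness_def
  by (simp only: ereal_le_inverse_iff tuple_norm_nonneg mem_Collect_eq)

context
  fixes X :: "'x topology" and A E f H K
  assumes W: "R_witness X A E f H K"
begin

lemma R_witness_length: "length (H n) = length (K n)"
  and R_witness_H: "set (H n) \<subseteq> A"
  and R_witness_K: "set (K n) \<subseteq> A"
  using W by (auto simp: R_witness_def)

context
  fixes w assumes w: "w \<in> topspace X"
begin

lemma R_witness_Reals: "f w \<in> \<real>"
  and R_witness_lower: "tuple_norm (K n) w \<le> Re (f w)"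
  and R_witness_upper: "Re (f w) * tuple_norm (H n) w \<le> 1"
  using W w by (auto simp: R_witness_def)

lemma R_witness_nonneg: "Re (f w) \<ge> 0"
  using R_witness_lower[of 0] by (meson order_trans tuple_norm_nonneg)

lemma R_witness_norm: "cmod (f w) = Re (f w)"
  using R_witness_nonneg R_witness_Reals by (auto elim!: Reals_cases)

text \<open>Cauchy-Schwarz and the two bounds on \<open>f\<close> combine. The estimate also holds
  on \<open>E\<close>, where no convergence of the dot products is available.\<close>

lemma R_witness_dot_norm: "cmod (tuple_dot (H n) (K n) w) \<le> 1"
proof -
  have "cmod (tuple_dot (H n) (K n) w) \<le> tuple_norm (H n) w * tuple_norm (K n) w"
    by (rule norm_tuple_dot_le[OF R_witness_length])
  also have "\<dots> \<le> tuple_norm (H n) w * Re (f w)"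
    by (intro mult_left_mono R_witness_lower) simp
  also have "\<dots> \<le> 1"
    using R_witness_upper by (simp add: mult.commute)
  finally show ?thesis .
qed

text \<open>A singleton off \<open>E\<close> is compact, so uniform convergence on compact sets
  applies to it.\<close>

lemma R_witness_dot_limit:
  assumes "w \<notin> E"
  shows "(\<lambda>n. tuple_dot (H n) (K n) w) \<longlonglongrightarrow> 1"
proof -
  have "compactin X {w} \<and> {w} \<subseteq> topspace X - E"
    using w assms by simp
  then have "uniform_limit {w} (\<lambda>n w. tuple_dot (H n) (K n) w) (\<lambda>_. 1) sequentially"
    using W unfolding R_witness_def by blast
  then show ?thesis
    by (rule tendsto_uniform_limitI) simp
qed

text \<open>Multiplying Cauchy-Schwarz by \<open>f\<close> and absorbing \<open>f\<close> times the
  norm of \<open>H n\<close> gives a lower bound for the norm of \<open>K n\<close>. As the dot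
  product tends to 1, \<open>f\<close> is squeezed off \<open>E\<close> and so is determined there
  by \<open>K\<close>.\<close>

lemma R_witness_lower_mult: "Re (f w) * cmod (tuple_dot (H n) (K n) w) \<le> tuple_norm (K n) w"
proof -
  have "Re (f w) * cmod (tuple_dot (H n) (K n) w) \<le>
      Re (f w) * (tuple_norm (H n) w * tuple_norm (K n) w)"
    by (intro mult_left_mono norm_tuple_dot_le R_witness_length R_witness_nonneg)
  also have "\<dots> = (Re (f w) * tuple_norm (H n) w) * tuple_norm (K n) w"
    by simp
  also have "\<dots> \<le> tuple_norm (K n) w"
    using R_witness_upper mult_right_mono[of _ 1 "tuple_norm (K n) w"] by simp
  finally show ?thesis .
qed

lemma R_witness_norm_limit:
  assumes "w \<notin> E"
  shows "(\<lambda>n. tuple_norm (K n) w) \<longlonglongrightarrow> Re (f w)"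
proof (rule tendsto_sandwich)
  show "(\<lambda>n. Re (f w) * cmod (tuple_dot (H n) (K n) w)) \<longlonglongrightarrow> Re (f w)"
    using tendsto_mult_left[OF tendsto_norm[OF R_witness_dot_limit[OF assms]], of "Re (f w)"]
    by simp
qed (use R_witness_lower_mult R_witness_lower in auto)

end
end

lemma fconst_apply [simp]: "x \<in> topspace X \<Longrightarrow> fconst X c x = c"
  by (simp add: fconst_def)

lemma fadd_apply [simp]: "x \<in> topspace X \<Longrightarrow> fadd X f g x = f x + g x"
  by (simp add: fadd_def)

lemma fmult_apply [simp]: "x \<in> topspace X \<Longrightarrow> fmult X f g x = f x * g x"
  by (simp add: fmult_def)

section \<open>Characters of a uniform algebra\<close>

locale uniform_alg =
  fixes X :: "'x topology" and A :: "('x \<Rightarrow> complex) set"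
  assumes uniform_algebra: "uniform_algebra X A"
begin

abbreviation "M \<equiv> max_ideal_space X A"
abbreviation "G \<equiv> gelfand X A"
abbreviation "\<Phi> \<equiv> characters X A"

lemma compact_space: "compact_space X"
  and A_C: "a \<in> A \<Longrightarrow> a \<in> mspace (C_space X)"
  and fconst_in_A: "fconst X c \<in> A"
  and fadd_in_A: "a \<in> A \<Longrightarrow> b \<in> A \<Longrightarrow> fadd X a b \<in> A"
  and fmult_in_A: "a \<in> A \<Longrightarrow> b \<in> A \<Longrightarrow> fmult X a b \<in> A"
  and separates: "x \<in> topspace X \<Longrightarrow> y \<in> topspace X \<Longrightarrow> x \<noteq> y \<Longrightarrow> \<exists>a\<in>A. a x \<noteq> a y"
  using uniform_algebra unfolding uniform_algebra_def subset_iff by meson+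

lemma continuous_A: "a \<in> A \<Longrightarrow> continuous_map X euclidean a"
  and extensional_A: "a \<in> A \<Longrightarrow> a \<in> extensional (topspace X)"
  using A_C by (auto simp: mem_C_space_iff)

lemma limit_in_A:
  assumes "g \<in> extensional (topspace X)"
    and "\<And>e. e > 0 \<Longrightarrow> \<exists>s\<in>A. \<forall>x\<in>topspace X. cmod (s x - g x) \<le> e"
  shows "g \<in> A"
proof -
  have "mtopology_of (C_space X) closure_of A = A"
    using uniform_algebra by (simp add: uniform_algebra_def closure_of_closedin)
  moreover have "A \<subseteq> mspace (C_space X)"
    using A_C by blast
  ultimately show ?thesis
    using C_closure_iff[of A X g] assms by auto
qed

lemma topspace_M [simp]: "topspace M = \<Phi>"
  by (auto simp: max_ideal_space_def characters_def PiE_def)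

lemma gelfand_apply [simp]: "\<phi> \<in> \<Phi> \<Longrightarrow> G a \<phi> = \<phi> a"
  by (simp add: gelfand_def)

lemma char_fadd: "\<phi> \<in> \<Phi> \<Longrightarrow> a \<in> A \<Longrightarrow> b \<in> A \<Longrightarrow> \<phi> (fadd X a b) = \<phi> a + \<phi> b"
  and char_fmult: "\<phi> \<in> \<Phi> \<Longrightarrow> a \<in> A \<Longrightarrow> b \<in> A \<Longrightarrow> \<phi> (fmult X a b) = \<phi> a * \<phi> b"
  by (auto simp: characters_def)

lemma char_fconst:
  assumes "\<phi> \<in> \<Phi>"
  shows "\<phi> (fconst X c) = c"
proof -
  have "fmult X (fconst X c) (fconst X 1) = fconst X c"
    by (auto simp: fmult_def fconst_def)
  moreover have "\<phi> (fmult X (fconst X c) (fconst X 1)) = c * 1"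
    using assms fconst_in_A[of 1] by (auto simp: characters_def)
  ultimately show ?thesis by simp
qed

text \<open>If \<open>\<bar>a\<bar> \<le> r < 1\<close> then \<open>1 - a\<close> is invertible in \<open>A\<close> by the geometric series, so no
  character takes the value 1 at \<open>a\<close>.\<close>

lemma char_neq_1:
  assumes phi: "\<phi> \<in> \<Phi>" and u: "u \<in> A" and r: "0 \<le> r" "r < 1"
    and le: "\<And>x. x \<in> topspace X \<Longrightarrow> cmod (u x) \<le> r"
  shows "\<phi> u \<noteq> 1"
proof
  assume u1: "\<phi> u = 1"
  define b where "b = (\<lambda>x\<in>topspace X. 1 / (1 - u x))"
  \<comment> \<open>The \<open>n\<close>-th partial sum of the geometric series in Horner form: it
    iterates, from 0, the contraction whose fixed point is \<open>b\<close>.\<close>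
  define p where "p n = ((\<lambda>s. fadd X (fconst X 1) (fmult X u s)) ^^ n) (fconst X 0)" for n :: nat
  have p: "p n \<in> A" for n
    by (induction n) (auto simp: p_def intro!: fadd_in_A fmult_in_A fconst_in_A u)
  have ne: "1 - u x \<noteq> 0" if "x \<in> topspace X" for x
    using le[OF that] r by auto
  have bx: "b x = 1 + u x * b x" if "x \<in> topspace X" for x
    using that ne[OF that] by (simp add: b_def add_divide_eq_iff)
  have pb: "cmod (p n x - b x) \<le> r ^ n * (1 / (1 - r))" if x: "x \<in> topspace X" for n x
  proof (induction n)
    case 0
    have "1 - r \<le> cmod (1 - u x)"
      using le[OF x] norm_triangle_ineq2[of 1 "u x"] by simp
    then have "1 / cmod (1 - u x) \<le> 1 / (1 - r)"
      using r by (intro divide_left_mono mult_pos_pos) auto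
    then show ?case
      using x by (simp add: p_def b_def fconst_def norm_divide)
  next
    case (Suc n)
    have "p (Suc n) x - b x = 1 + u x * p n x - (1 + u x * b x)"
      using x bx[OF x] by (simp add: p_def fadd_def fmult_def fconst_def)
    also have "\<dots> = u x * (p n x - b x)"
      by (simp add: algebra_simps)
    finally have "cmod (p (Suc n) x - b x) = cmod (u x) * cmod (p n x - b x)"
      by (simp add: norm_mult)
    also have "\<dots> \<le> r * (r ^ n * (1 / (1 - r)))"
      using Suc le[OF x] r by (intro mult_mono) auto
    finally show ?case by simp
  qed
  have "b \<in> A"
  proof (rule limit_in_A)
    show "b \<in> extensional (topspace X)" by (simp add: b_def)
    fix e :: real assume "e > 0"
    then have "e * (1 - r) > 0" using r by simp
    then obtain n where "r ^ n < e * (1 - r)"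
      using real_arch_pow_inv[OF _ r(2)] by blast
    then have "r ^ n * (1 / (1 - r)) \<le> e"
      using r by (simp add: field_simps)
    then show "\<exists>s\<in>A. \<forall>x\<in>topspace X. cmod (s x - b x) \<le> e"
      using p[of n] pb[of _ n] by (meson order_trans)
  qed
  moreover have "b = fadd X (fconst X 1) (fmult X u b)"
  proof (rule extensionalityI)
    fix x assume "x \<in> topspace X"
    then show "b x = fadd X (fconst X 1) (fmult X u b) x"
      using bx[of x] by (simp add: fadd_def fmult_def)
  qed (auto simp: b_def fadd_def)
  \<comment> \<open>Evaluating the fixed point equation at a character with
    \<open>\<phi> u = 1\<close> gives \<open>\<phi> b = 1 + \<phi> b\<close>.\<close>
  ultimately have "\<phi> b = 1 + \<phi> u * \<phi> b"
    using char_fadd[OF phi fconst_in_A fmult_in_A[OF u]] char_fmult[OF phi u]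
      char_fconst[OF phi] by metis
  with u1 show False by simp
qed

text \<open>Otherwise dividing \<open>a\<close> by \<open>\<phi> a\<close> gives an element with
  value 1 at \<open>\<phi>\<close> and sup norm below 1, against \<open>char_neq_1\<close>. All
  later transfers of bounds to characters rest on this one.\<close>

lemma char_norm_le:
  assumes phi: "\<phi> \<in> \<Phi>" and a: "a \<in> A" and C: "C \<ge> 0"
    and le: "\<And>x. x \<in> topspace X \<Longrightarrow> cmod (a x) \<le> C"
  shows "cmod (\<phi> a) \<le> C"
proof (rule ccontr)
  assume "\<not> ?thesis"
  then have less: "C < cmod (\<phi> a)" by simp
  define u where "u = fmult X (fconst X (1 / \<phi> a)) a"
  have "\<phi> u = 1 / \<phi> a * \<phi> a"
    by (simp add: u_def char_fmult phi a fconst_in_A char_fconst)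
  then have "\<phi> u = 1"
    using less C by auto
  moreover have "\<phi> u \<noteq> 1"
  proof (rule char_neq_1[OF phi])
    show "u \<in> A" by (simp add: u_def fmult_in_A fconst_in_A a)
    show "0 \<le> C / cmod (\<phi> a)" "C / cmod (\<phi> a) < 1"
      using C less by (auto simp: divide_less_eq)
    fix x assume x: "x \<in> topspace X"
    then show "cmod (u x) \<le> C / cmod (\<phi> a)"
      using le[OF x] by (simp add: u_def fmult_def norm_divide norm_mult divide_right_mono)
  qed
  ultimately show False by blast
qed

text \<open>Membership and evaluation share one induction, since additivity of \<open>\<phi>\<close>
  applies only once the partial sum is known to lie in \<open>A\<close>.\<close>

lemma sum_in_A:
  fixes g :: "nat \<Rightarrow> 'x \<Rightarrow> complex"
  assumes "\<And>i. i < n \<Longrightarrow> g i \<in> A"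
  shows "(\<lambda>x\<in>topspace X. \<Sum>i<n. g i x) \<in> A \<and>
    (\<forall>\<phi>\<in>\<Phi>. \<phi> (\<lambda>x\<in>topspace X. \<Sum>i<n. g i x) = (\<Sum>i<n. \<phi> (g i)))"
  using assms
proof (induction n)
  case 0
  have "(\<lambda>x\<in>topspace X. \<Sum>i<0. g i x) = fconst X 0"
    by (simp add: fconst_def)
  then show ?case
    using fconst_in_A[of 0] char_fconst[of _ 0] by (metis lessThan_0 sum.empty)
next
  case (Suc n)
  define s where "s = (\<lambda>x\<in>topspace X. \<Sum>i<n. g i x)"
  have eq: "(\<lambda>x\<in>topspace X. \<Sum>i<Suc n. g i x) = fadd X s (g n)"
    by (auto simp: fadd_def s_def)
  have "s \<in> A \<and> (\<forall>\<phi>\<in>\<Phi>. \<phi> s = (\<Sum>i<n. \<phi> (g i)))"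
    unfolding s_def by (rule Suc.IH) (simp add: Suc.prems)
  then show ?case
    unfolding eq using Suc.prems by (simp add: fadd_in_A char_fadd)
qed

lemma power_in_A:
  assumes a: "a \<in> A"
  obtains b where "b \<in> A" "\<And>x. x \<in> topspace X \<Longrightarrow> b x = a x ^ j"
    "\<And>\<phi>. \<phi> \<in> \<Phi> \<Longrightarrow> \<phi> b = \<phi> a ^ j"
proof -
  have "\<exists>b\<in>A. (\<forall>x\<in>topspace X. b x = a x ^ j) \<and> (\<forall>\<phi>\<in>\<Phi>. \<phi> b = \<phi> a ^ j)"
  proof (induction j)
    case 0
    show ?case
      by (intro bexI[of _ "fconst X 1"]) (auto simp: fconst_in_A char_fconst)
  next
    case (Suc j)
    then obtain b where "b \<in> A" "\<forall>x\<in>topspace X. b x = a x ^ j" "\<forall>\<phi>\<in>\<Phi>. \<phi> b = \<phi> a ^ j"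
      by blast
    then show ?case
      using a by (intro bexI[of _ "fmult X a b"]) (auto simp: fmult_in_A char_fmult)
  qed
  with that show thesis by blast
qed

lemma tuple_norm_gelfand:
  "\<phi> \<in> \<Phi> \<Longrightarrow> tuple_norm (map G ks) \<phi> = L2_set (\<lambda>i. cmod (\<phi> (ks ! i))) {..<length ks}"
  unfolding tuple_norm_def by (auto intro!: L2_set_cong)

text \<open>The element is the linear combination of the tuple whose coefficients form the unit vector for
  which the Cauchy-Schwarz inequality is sharp at \<open>\<phi>\<close>.\<close>

lemma tuple_norm_attained:
  assumes phi: "\<phi> \<in> \<Phi>" and ks: "set ks \<subseteq> A"
  obtains b where "b \<in> A" "\<phi> b = tuple_norm (map G ks) \<phi>"
    "\<And>x. x \<in> topspace X \<Longrightarrow> cmod (b x) \<le> tuple_norm ks x"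
proof (cases "tuple_norm (map G ks) \<phi> = 0")
  \<comment> \<open>The normalised coefficients below would divide by 0 here, and the zero function
    suffices.\<close>
  case True
  with phi show thesis
    by (intro that[of "fconst X 0"]) (auto simp: fconst_in_A char_fconst)
next
  case False
  define N where "N = tuple_norm (map G ks) \<phi>"
  have N: "N > 0"
    using False tuple_norm_nonneg[of "map G ks" \<phi>] unfolding N_def by linarith
  define c where "c i = cnj (\<phi> (ks ! i)) / N" for i
  define g where "g i = fmult X (fconst X (c i)) (ks ! i)" for i
  define b where "b = (\<lambda>x\<in>topspace X. \<Sum>i<length ks. g i x)"
  have k: "ks ! i \<in> A" if "i < length ks" for i
    using ks that by auto
  then have g: "g i \<in> A" if "i < length ks" for i
    using that by (simp add: g_def fmult_in_A fconst_in_A)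
  note b = sum_in_A[of "length ks" g, OF g, folded b_def]
  show thesis
  proof (rule that)
    show "b \<in> A" using b by blast
    have "\<phi> b = (\<Sum>i<length ks. c i * \<phi> (ks ! i))"
      using b phi k by (auto simp: g_def char_fmult fconst_in_A char_fconst intro!: sum.cong)
    also have "\<dots> = of_real ((\<Sum>i<length ks. (cmod (\<phi> (ks ! i)))\<^sup>2) / N)"
      by (simp add: c_def sum_divide_distrib complex_norm_square mult.commute del: of_real_power)
    also have "(\<Sum>i<length ks. (cmod (\<phi> (ks ! i)))\<^sup>2) = N\<^sup>2"
      by (simp add: N_def tuple_norm_gelfand[OF phi] L2_set_def sum_nonneg)
    finally show "\<phi> b = tuple_norm (map G ks) \<phi>"
      using N by (simp add: power2_eq_square flip: N_def)
    fix x assume x: "x \<in> topspace X"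
    have "cmod (b x) \<le> (\<Sum>i<length ks. cmod (c i) * cmod ((ks ! i) x))"
      using x unfolding b_def g_def
      by (auto simp: fmult_def fconst_def norm_mult intro!: order_trans[OF norm_sum])
    also have "\<dots> \<le> L2_set (\<lambda>i. cmod (c i)) {..<length ks} * tuple_norm ks x"
      using L2_set_mult_ineq[of "\<lambda>i. cmod (c i)" "\<lambda>i. cmod ((ks ! i) x)" "{..<length ks}"]
      by (simp add: tuple_norm_def)
    also have "L2_set (\<lambda>i. cmod (c i)) {..<length ks} =
        inverse N * L2_set (\<lambda>i. cmod (\<phi> (ks ! i))) {..<length ks}"
      using N by (subst L2_set_right_distrib) (auto simp: c_def norm_divide field_simps)
    also have "\<dots> = 1"
      using N by (simp flip: tuple_norm_gelfand[OF phi] N_def)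
    finally show "cmod (b x) \<le> tuple_norm ks x" by simp
  qed
qed

text \<open>The tuple is replaced by the single element \<open>b\<close> that attains its norm at
  \<open>\<phi>\<close>; then \<open>a b\<close> lies in \<open>A\<close> and is bounded by
  \<open>C\<close> on \<open>X\<close>.\<close>

lemma char_mult_tuple_norm_le:
  assumes phi: "\<phi> \<in> \<Phi>" and a: "a \<in> A" and ks: "set ks \<subseteq> A" and C: "C \<ge> 0"
    and le: "\<And>x. x \<in> topspace X \<Longrightarrow> cmod (a x) * tuple_norm ks x \<le> C"
  shows "cmod (\<phi> a) * tuple_norm (map G ks) \<phi> \<le> C"
proof -
  obtain b where b: "b \<in> A" "\<phi> b = tuple_norm (map G ks) \<phi>"
    "\<And>x. x \<in> topspace X \<Longrightarrow> cmod (b x) \<le> tuple_norm ks x"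
    using tuple_norm_attained[OF phi ks] by blast
  have "cmod (\<phi> (fmult X a b)) \<le> C"
  proof (rule char_norm_le[OF phi fmult_in_A[OF a b(1)] C])
    fix x assume x: "x \<in> topspace X"
    have "cmod (a x) * cmod (b x) \<le> cmod (a x) * tuple_norm ks x"
      by (intro mult_left_mono b x) simp
    then show "cmod (fmult X a b x) \<le> C"
      using le[OF x] x by (simp add: fmult_def norm_mult)
  qed
  then show ?thesis
    by (simp add: char_fmult phi a b norm_mult)
qed

text \<open>The first tuple is replaced by an element attaining its norm at \<open>\<phi>\<close>,
  which reduces the claim to the case of one element and one tuple.\<close>

lemma tuple_norm_mult_le:
  assumes phi: "\<phi> \<in> \<Phi>" and hs: "set hs \<subseteq> A" and ks: "set ks \<subseteq> A" and C: "C \<ge> 0"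
    and le: "\<And>x. x \<in> topspace X \<Longrightarrow> tuple_norm hs x * tuple_norm ks x \<le> C"
  shows "tuple_norm (map G hs) \<phi> * tuple_norm (map G ks) \<phi> \<le> C"
proof -
  obtain b where b: "b \<in> A" "\<phi> b = tuple_norm (map G hs) \<phi>"
    "\<And>x. x \<in> topspace X \<Longrightarrow> cmod (b x) \<le> tuple_norm hs x"
    using tuple_norm_attained[OF phi hs] by blast
  have "cmod (\<phi> b) * tuple_norm (map G ks) \<phi> \<le> C"
  proof (rule char_mult_tuple_norm_le[OF phi b(1) ks C])
    fix x assume x: "x \<in> topspace X"
    have "cmod (b x) * tuple_norm ks x \<le> tuple_norm hs x * tuple_norm ks x"
      by (intro mult_right_mono b x) simp
    then show "cmod (b x) * tuple_norm ks x \<le> C"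
      using le[OF x] by simp
  qed
  then show ?thesis by (simp add: b)
qed

text \<open>The dot product is again an element of \<open>A\<close>, so the transfer of bounds to
  characters applies to it directly.\<close>

lemma tuple_dot_gelfand:
  assumes hs: "set hs \<subseteq> A" and ks: "set ks \<subseteq> A" and len: "length hs = length ks"
  shows "(\<lambda>x\<in>topspace X. tuple_dot hs ks x) \<in> A"
    and "\<phi> \<in> \<Phi> \<Longrightarrow> tuple_dot (map G hs) (map G ks) \<phi> = \<phi> (\<lambda>x\<in>topspace X. tuple_dot hs ks x)"
proof -
  have mem: "hs ! i \<in> A" "ks ! i \<in> A" if "i < length hs" for i
    using that hs ks len by auto
  define g where "g i = fmult X (hs ! i) (ks ! i)" for i
  have eq: "(\<lambda>x\<in>topspace X. \<Sum>i<length hs. g i x) = (\<lambda>x\<in>topspace X. tuple_dot hs ks x)"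
    by (auto simp: g_def fmult_def tuple_dot_def)
  have g: "g i \<in> A" if "i < length hs" for i
    using mem[OF that] by (simp add: g_def fmult_in_A)
  note s = sum_in_A[of "length hs" g, OF g, unfolded eq]
  show "(\<lambda>x\<in>topspace X. tuple_dot hs ks x) \<in> A"
    using s by blast
  assume phi: "\<phi> \<in> \<Phi>"
  have "\<phi> (\<lambda>x\<in>topspace X. tuple_dot hs ks x) = (\<Sum>i<length hs. \<phi> (hs ! i) * \<phi> (ks ! i))"
    using s phi mem by (auto simp: g_def char_fmult)
  then show "tuple_dot (map G hs) (map G ks) \<phi> = \<phi> (\<lambda>x\<in>topspace X. tuple_dot hs ks x)"
    using phi len by (simp add: tuple_dot_def)
qed

lemma pt_eval_in_characters: "x \<in> topspace X \<Longrightarrow> pt_eval A x \<in> \<Phi>"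
  by (auto simp: characters_def pt_eval_def fconst_in_A fadd_in_A fmult_in_A)

lemma pt_eval_apply [simp]: "a \<in> A \<Longrightarrow> pt_eval A x a = a x"
  by (simp add: pt_eval_def)

lemma continuous_pt_eval: "continuous_map X M (pt_eval A)"
  unfolding max_ideal_space_def
proof (rule continuous_map_into_subtopology)
  show "continuous_map X (product_topology (\<lambda>_. euclidean) A) (pt_eval A)"
    by (auto simp: continuous_map_componentwise continuous_A extensional_def pt_eval_def)
qed (use pt_eval_in_characters in auto)

lemma tuple_norm_pt_eval:
  assumes "x \<in> topspace X" "set ks \<subseteq> A"
  shows "tuple_norm (map G ks) (pt_eval A x) = tuple_norm ks x"
proof -
  have "ks ! i \<in> A" if "i < length ks" for i
    using assms(2) that by auto
  then show ?thesis
    unfolding tuple_norm_gelfand[OF pt_eval_in_characters[OF assms(1)]]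
    by (auto simp: tuple_norm_def intro!: L2_set_cong)
qed

lemma continuous_map_eval:
  assumes a: "a \<in> A"
  shows "continuous_map M euclidean (\<lambda>\<phi>. \<phi> a)"
  unfolding max_ideal_space_def
  by (intro continuous_map_from_subtopology continuous_map_product_projection a)

lemma gelfand_in_C_space:
  assumes a: "a \<in> A"
  shows "G a \<in> mspace (C_space M)"
  unfolding mem_C_space_iff
proof (intro conjI exI ballI)
  show "continuous_map M euclidean (G a)"
    by (rule continuous_map_eq[OF continuous_map_eval[OF a]]) simp
  show "G a \<in> extensional (topspace M)"
    by (simp add: gelfand_def)
  fix \<phi> assume "\<phi> \<in> topspace M"
  then show "cmod (G a \<phi>) \<le> sup_norm X a"
    using norm_le_sup_norm[OF A_C[OF a]] sup_norm_nonneg[OF A_C[OF a]] char_norm_le a by auto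
qed

lemma continuous_tuple_norm_gelfand:
  assumes ks: "set ks \<subseteq> A"
  shows "continuous_map M euclidean (tuple_norm (map G ks))"
proof -
  have "continuous_map M euclidean (\<lambda>\<phi>. sqrt (\<Sum>i<length ks. (cmod (\<phi> (ks ! i)))\<^sup>2))"
  proof -
    have "continuous_map M euclidean (\<lambda>\<phi>. \<Sum>i<length ks. (cmod (\<phi> (ks ! i)))\<^sup>2)"
      using ks by (intro continuous_map_sum continuous_map_real_pow continuous_map_norm
        continuous_map_eval) auto
    then show ?thesis
      by (simp add: continuous_map_atin tendsto_real_sqrt)
  qed
  then show ?thesis
    by (rule continuous_map_eq) (simp add: tuple_norm_gelfand L2_set_def)
qed

end

section \<open>Extension to the maximal ideal space\<close>

context uniform_alg
begin

text \<open>Choosing preimages under the Gelfand transform brings arbitrary witnesses on the maximal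
  ideal space within reach of the transfer lemmas for tuples over \<open>A\<close>.\<close>

lemma R_witness_gelfandE:
  assumes "R_witness Y (G ` A) D f H K"
  obtains hs ks where "H = (\<lambda>n. map G (hs n))" "K = (\<lambda>n. map G (ks n))"
    "\<And>n. set (hs n) \<subseteq> A" "\<And>n. set (ks n) \<subseteq> A"
proof -
  have lift: "\<exists>ys. xs = map G ys \<and> set ys \<subseteq> A" if "set xs \<subseteq> G ` A" for xs
    using that
  proof (induction xs)
    case (Cons x xs)
    then obtain a ys where "x = G a" "a \<in> A" "xs = map G ys" "set ys \<subseteq> A"
      by auto
    then show ?case
      by (intro exI[of _ "a # ys"]) auto
  qed simp
  have "\<forall>n. \<exists>ys. H n = map G ys \<and> set ys \<subseteq> A" "\<forall>n. \<exists>ys. K n = map G ys \<and> set ys \<subseteq> A"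
    using R_witness_H[OF assms] R_witness_K[OF assms] lift by blast+
  then obtain hs ks where "\<forall>n. H n = map G (hs n) \<and> set (hs n) \<subseteq> A"
    "\<forall>n. K n = map G (ks n) \<and> set (ks n) \<subseteq> A"
    by metis
  with that[of hs ks] show thesis by auto
qed

text \<open>The witnesses are crossed: on \<open>X\<close> the norms of \<open>H2 m\<close> and
  \<open>K1 n\<close> have product at most 1, because \<open>f1\<close> is at most \<open>f2\<close>
  there. This transfers to \<open>\<phi>\<close>; letting \<open>n\<close> and then \<open>m\<close>
  tend to infinity recovers the inequality between the functions.\<close>

lemma R_class_gelfand_mono:
  assumes f1: "f1 \<in> R_class M (G ` A) D" and f2: "f2 \<in> R_class M (G ` A) D"
    and le: "\<And>x. x \<in> topspace X \<Longrightarrow> Re (f1 (pt_eval A x)) \<le> Re (f2 (pt_eval A x))"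
    and phi: "\<phi> \<in> \<Phi>"
  shows "Re (f1 \<phi>) \<le> Re (f2 \<phi>)"
proof (cases "\<phi> \<in> D")
  case True
  then have "f1 \<phi> = 0" "f2 \<phi> = 0"
    using f1 f2 unfolding R_class_iff by blast+
  then show ?thesis by simp
next
  case False
  obtain H1 K1 where W1: "R_witness M (G ` A) D f1 H1 K1"
    using f1 unfolding R_class_iff by blast
  obtain H2 K2 where W2: "R_witness M (G ` A) D f2 H2 K2"
    using f2 unfolding R_class_iff by blast
  from R_witness_gelfandE[OF W1] obtain h1 k1 where K1: "K1 = (\<lambda>n. map G (k1 n))" "\<And>n. set (k1 n) \<subseteq> A"
    by metis
  from R_witness_gelfandE[OF W2] obtain h2 k2 where H2: "H2 = (\<lambda>n. map G (h2 n))" "\<And>n. set (h2 n) \<subseteq> A"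
    by metis
  have phi': "\<phi> \<in> topspace M" using phi by simp
  have cross: "tuple_norm (H2 m) \<phi> * tuple_norm (K1 n) \<phi> \<le> 1" for m n
    unfolding H2 K1
  proof (rule tuple_norm_mult_le[OF phi H2(2) K1(2)])
    fix x assume x: "x \<in> topspace X"
    then have px: "pt_eval A x \<in> topspace M"
      by (simp add: pt_eval_in_characters)
    have "tuple_norm (h2 m) x * tuple_norm (k1 n) x =
        tuple_norm (H2 m) (pt_eval A x) * tuple_norm (K1 n) (pt_eval A x)"
      using x H2 K1 by (simp add: tuple_norm_pt_eval)
    also have "\<dots> \<le> tuple_norm (H2 m) (pt_eval A x) * Re (f2 (pt_eval A x))"
      using R_witness_lower[OF W1 px, of n] le[OF x] by (intro mult_left_mono) auto
    also have "\<dots> \<le> 1"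
      using R_witness_upper[OF W2 px, of m] by (simp add: mult.commute)
    finally show "tuple_norm (h2 m) x * tuple_norm (k1 n) x \<le> 1" .
  qed simp
  \<comment> \<open>Here \<open>m\<close> is fixed and \<open>n\<close> tends to infinity, which
    replaces the norm of \<open>K1 n\<close> by \<open>f1\<close>.\<close>
  have upper: "tuple_norm (H2 m) \<phi> * Re (f1 \<phi>) \<le> 1" for m
    using LIMSEQ_le_const2[OF tendsto_mult_left[OF R_witness_norm_limit[OF W1 phi' False]]] cross
    by blast
  have "cmod (tuple_dot (H2 m) (K2 m) \<phi>) * Re (f1 \<phi>) \<le> Re (f2 \<phi>)" for m
  proof -
    have "cmod (tuple_dot (H2 m) (K2 m) \<phi>) * Re (f1 \<phi>) \<le>
        (tuple_norm (H2 m) \<phi> * tuple_norm (K2 m) \<phi>) * Re (f1 \<phi>)"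
      by (intro mult_right_mono norm_tuple_dot_le R_witness_length[OF W2] R_witness_nonneg[OF W1 phi'])
    also have "\<dots> = (tuple_norm (H2 m) \<phi> * Re (f1 \<phi>)) * tuple_norm (K2 m) \<phi>"
      by simp
    also have "\<dots> \<le> tuple_norm (K2 m) \<phi>"
      using mult_right_mono[OF upper, of "tuple_norm (K2 m) \<phi>" m] by simp
    also have "\<dots> \<le> Re (f2 \<phi>)"
      by (rule R_witness_lower[OF W2 phi'])
    finally show ?thesis .
  qed
  moreover have "(\<lambda>m. cmod (tuple_dot (H2 m) (K2 m) \<phi>) * Re (f1 \<phi>)) \<longlonglongrightarrow> cmod 1 * Re (f1 \<phi>)"
    by (intro tendsto_intros R_witness_dot_limit[OF W2 phi' False])
  ultimately show ?thesis
    using LIMSEQ_le_const2 by fastforce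
qed

text \<open>Comparison in both directions; members of the class are real-valued, so real parts
  suffice.\<close>

lemma R_class_gelfand_unique:
  assumes f1: "f1 \<in> R_class M (G ` A) D" and f2: "f2 \<in> R_class M (G ` A) D"
    and eq: "\<And>x. x \<in> topspace X \<Longrightarrow> f1 (pt_eval A x) = f2 (pt_eval A x)"
  shows "f1 = f2"
proof (rule extensionalityI)
  show "f1 \<in> extensional \<Phi>" "f2 \<in> extensional \<Phi>"
    using f1 f2 by (auto simp: R_class_iff)
  fix \<phi> assume phi: "\<phi> \<in> \<Phi>"
  have "f1 \<phi> \<in> \<real>" "f2 \<phi> \<in> \<real>"
    using f1 f2 phi unfolding R_class_iff by (auto simp: R_witness_Reals)
  moreover have "Re (f1 \<phi>) = Re (f2 \<phi>)"
    using R_class_gelfand_mono[OF f1 f2 _ phi] R_class_gelfand_mono[OF f2 f1 _ phi] eq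
    by (metis antisym order_refl)
  ultimately show "f1 \<phi> = f2 \<phi>"
    by (auto elim!: Reals_cases)
qed

text \<open>On \<open>X\<close> the bound survives replacing \<open>ft\<close> by the smaller norms
  of \<open>K n\<close>. In that form it transfers to \<open>\<phi>\<close>, and off
  \<open>D\<close> these norms converge back to \<open>ft\<close>.\<close>

lemma R_class_gelfand_bound:
  assumes ft: "ft \<in> R_class M (G ` A) D"
    and a: "a \<in> A" and C: "C \<ge> 0"
    and le: "\<And>x. x \<in> topspace X \<Longrightarrow> cmod (a x * ft (pt_eval A x)) \<le> C"
    and phi: "\<phi> \<in> \<Phi>"
  shows "cmod (\<phi> a * ft \<phi>) \<le> C"
proof (cases "\<phi> \<in> D")
  case True
  with ft C show ?thesis
    unfolding R_class_iff by auto
next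
  case False
  obtain H K where W: "R_witness M (G ` A) D ft H K"
    using ft unfolding R_class_iff by blast
  from R_witness_gelfandE[OF W] obtain ks where K: "K = (\<lambda>n. map G (ks n))" "\<And>n. set (ks n) \<subseteq> A"
    by metis
  have phi': "\<phi> \<in> topspace M" using phi by simp
  have "cmod (\<phi> a) * tuple_norm (K n) \<phi> \<le> C" for n
    unfolding K
  proof (rule char_mult_tuple_norm_le[OF phi a K(2) C])
    fix x assume x: "x \<in> topspace X"
    then have px: "pt_eval A x \<in> topspace M"
      by (simp add: pt_eval_in_characters)
    have "tuple_norm (ks n) x \<le> cmod (ft (pt_eval A x))"
      using R_witness_lower[OF W px, of n] R_witness_norm[OF W px] x K
      by (simp add: tuple_norm_pt_eval)
    then have "cmod (a x) * tuple_norm (ks n) x \<le> cmod (a x) * cmod (ft (pt_eval A x))"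
      by (intro mult_left_mono) auto
    with le[OF x] show "cmod (a x) * tuple_norm (ks n) x \<le> C"
      by (simp add: norm_mult)
  qed
  then have "cmod (\<phi> a) * Re (ft \<phi>) \<le> C"
    using LIMSEQ_le_const2[OF tendsto_mult_left[OF R_witness_norm_limit[OF W phi' False]]] by blast
  then show ?thesis
    by (simp add: norm_mult R_witness_norm[OF W phi'])
qed

end

section \<open>Construction of the extension\<close>

lemma attains_max_on_closed:
  fixes g :: "'x \<Rightarrow> real"
  assumes "compactin X S" "S \<noteq> {}" "continuous_map X euclidean g"
  obtains x where "x \<in> S" "\<And>y. y \<in> S \<Longrightarrow> g y \<le> g x"
proof -
  have "compact (g ` S)"
    using image_compactin[OF assms(1,3)] by simp
  then show thesis
    using compact_attains_sup[of "g ` S"] assms(2) that by blast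
qed

lemma closedin_norm_ge:
  assumes "continuous_map X euclidean (g :: 'x \<Rightarrow> complex)"
  shows "closedin X {x \<in> topspace X. e \<le> cmod (g x)}"
proof -
  have "closedin X {x \<in> topspace X. cmod (g x) \<in> {e..}}"
    by (rule closedin_continuous_map_preimage[OF continuous_map_norm[OF assms]]) simp
  then show ?thesis by simp
qed

text \<open>The peak function \<open>q\<close> is fixed with the witness because the characters with
  value 1 at \<open>q\<close> will form the zero set of the extension.\<close>

locale R_extension = uniform_alg +
  fixes E f H K q
  assumes f: "f \<in> mspace (C_space X)" and zeros: "{w \<in> topspace X. f w = 0} = E"
    and W: "R_witness X A E f H K"
    and q: "q \<in> A" and q_E: "E = {x \<in> topspace X. q x = 1}"
    and q_less: "x \<in> topspace X - E \<Longrightarrow> cmod (q x) < 1"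
begin

lemma q_le: "x \<in> topspace X \<Longrightarrow> cmod (q x) \<le> 1"
  using q_less[of x] by (cases "x \<in> E") (auto simp: q_E)

lemma char_q_le: "\<phi> \<in> \<Phi> \<Longrightarrow> cmod (\<phi> q) \<le> 1"
  using char_norm_le[OF _ q] q_le by simp

definition B where "B = sup_norm X f"

lemma B_nonneg: "B \<ge> 0"
  unfolding B_def by (rule sup_norm_nonneg[OF f])

lemma f_le_B: "x \<in> topspace X \<Longrightarrow> Re (f x) \<le> B"
  using norm_le_sup_norm[OF f] R_witness_norm[OF W] by (auto simp: B_def)

text \<open>Where \<open>f\<close> is below \<open>e\<close>, every power works. The remaining set
  is compact and misses \<open>E\<close>, so the maximum of \<open>cmod (q x)\<close> on it is below
  1 and a high power outweighs the bound \<open>B\<close>.\<close>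

lemma power_mult_f_small:
  assumes e: "e > 0"
  shows "\<exists>j. \<forall>x\<in>topspace X. cmod (q x) ^ j * Re (f x) \<le> e"
proof -
  define S where "S = {x \<in> topspace X. e \<le> cmod (f x)}"
  have "closedin X S"
    unfolding S_def using f by (intro closedin_norm_ge) auto
  then have S: "compactin X S"
    by (rule closedin_compact_space[OF compact_space])
  have small: "cmod (q x) ^ j * Re (f x) \<le> e" if x: "x \<in> topspace X" "x \<notin> S" for x j
  proof -
    have "cmod (q x) ^ j * Re (f x) \<le> 1 * Re (f x)"
      using q_le[OF x(1)] R_witness_nonneg[OF W x(1)]
      by (intro mult_right_mono power_le_one) auto
    with x show ?thesis
      by (simp add: S_def R_witness_norm[OF W])
  qed
  show ?thesis
  proof (cases "S = {}")
    case True
    with small show ?thesis by blast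
  next
    case False
    obtain x0 where x0: "x0 \<in> S" and max: "\<And>x. x \<in> S \<Longrightarrow> cmod (q x) \<le> cmod (q x0)"
      using attains_max_on_closed[OF S False continuous_map_norm[OF continuous_A[OF q]]] by blast
    have "x0 \<in> topspace X - E"
      using x0 e zeros by (auto simp: S_def)
    then have lt: "cmod (q x0) < 1" by (rule q_less)
    then obtain j where j: "cmod (q x0) ^ j < e / (B + 1)"
      using real_arch_pow_inv[of "e / (B + 1)"] e B_nonneg by fastforce
    have "cmod (q x) ^ j * Re (f x) \<le> e" if x: "x \<in> topspace X" "x \<in> S" for x
    proof -
      have "cmod (q x) ^ j * Re (f x) \<le> cmod (q x0) ^ j * B"
        using max[OF x(2)] f_le_B[OF x(1)] R_witness_nonneg[OF W x(1)]
        by (intro mult_mono power_mono) auto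
      also have "\<dots> \<le> e / (B + 1) * B"
        using j B_nonneg by (intro mult_right_mono) auto
      also have "\<dots> \<le> e"
        using e B_nonneg by (simp add: field_simps)
      finally show ?thesis .
    qed
    with small show ?thesis by blast
  qed
qed

definition dot where "dot n = (\<lambda>x\<in>topspace X. tuple_dot (H n) (K n) x)"

lemma dot_in_A: "dot n \<in> A"
  unfolding dot_def
  using R_witness_length[OF W] R_witness_H[OF W] R_witness_K[OF W] by (intro tuple_dot_gelfand)

lemma char_dot: "\<phi> \<in> \<Phi> \<Longrightarrow> tuple_dot (map G (H n)) (map G (K n)) \<phi> = \<phi> (dot n)"
  unfolding dot_def
  using R_witness_length[OF W] R_witness_H[OF W] R_witness_K[OF W] by (intro tuple_dot_gelfand)

text \<open>Convergence is given only on compact sets off \<open>E\<close>. The factor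
  \<open>1 - q\<close> is small near \<open>E\<close>, where \<open>dot n - 1\<close> is bounded by
  2, so the product converges uniformly on all of \<open>X\<close>.\<close>

lemma dot_limit_on_X:
  assumes e: "e > 0"
  shows "\<forall>\<^sub>F n in sequentially. \<forall>x\<in>topspace X. cmod (1 - q x) * cmod (dot n x - 1) \<le> e"
proof -
  \<comment> \<open>On \<open>S\<close> the dot product is within \<open>e/2\<close> of 1 and the
    factor is at most 2; off \<open>S\<close> the two roles are exchanged.\<close>
  define S where "S = {x \<in> topspace X. e / 2 \<le> cmod (1 - q x)}"
  have "closedin X S"
    unfolding S_def
    by (rule closedin_norm_ge[OF continuous_map_diff[OF continuous_map_canonical_const continuous_A[OF q]]])
  then have S: "compactin X S"
    by (rule closedin_compact_space[OF compact_space])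
  moreover have "S \<subseteq> topspace X - E"
    using e by (auto simp: S_def q_E)
  ultimately have "uniform_limit S (\<lambda>n w. tuple_dot (H n) (K n) w) (\<lambda>_. 1) sequentially"
    using W unfolding R_witness_def by blast
  then have "\<forall>\<^sub>F n in sequentially. \<forall>x\<in>S. dist (tuple_dot (H n) (K n) x) 1 < e / 2"
    using e unfolding uniform_limit_iff by (meson half_gt_zero)
  then show ?thesis
  proof (rule eventually_mono, intro ballI)
    fix n x assume n: "\<forall>x\<in>S. dist (tuple_dot (H n) (K n) x) 1 < e / 2" and x: "x \<in> topspace X"
    have d: "dot n x = tuple_dot (H n) (K n) x"
      using x by (simp add: dot_def)
    show "cmod (1 - q x) * cmod (dot n x - 1) \<le> e"
    proof (cases "x \<in> S")
      case True
      have "cmod (1 - q x) * cmod (dot n x - 1) \<le> 2 * (e / 2)"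
        using n True d q_le[OF x] norm_triangle_ineq4[of 1 "q x"]
        by (intro mult_mono) (auto simp: dist_norm less_imp_le)
      then show ?thesis by simp
    next
      case False
      have "cmod (1 - q x) * cmod (dot n x - 1) \<le> e / 2 * 2"
        using False d x R_witness_dot_norm[OF W x, of n] norm_triangle_ineq4[of "dot n x" 1] e
        by (intro mult_mono) (auto simp: S_def)
      then show ?thesis by simp
    qed
  qed
qed

text \<open>The product lies in \<open>A\<close>, so its bound on \<open>X\<close> holds at every
  character for the same \<open>n\<close>; this keeps the convergence uniform.\<close>

lemma dot_limit:
  assumes e: "e > 0"
  shows "\<forall>\<^sub>F n in sequentially. \<forall>\<phi>\<in>\<Phi>. cmod (1 - \<phi> q) * cmod (\<phi> (dot n) - 1) \<le> e"
  using dot_limit_on_X[OF e]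
proof (rule eventually_mono, intro ballI)
  fix n \<phi> assume n: "\<forall>x\<in>topspace X. cmod (1 - q x) * cmod (dot n x - 1) \<le> e"
    and phi: "\<phi> \<in> \<Phi>"
  \<comment> \<open>\<open>u\<close> and \<open>v\<close> are \<open>1 - q\<close> and
    \<open>dot n - 1\<close>, written with the operations under which \<open>A\<close> is
    closed.\<close>
  define u where "u = fadd X (fconst X 1) (fmult X (fconst X (-1)) q)"
  define v where "v = fadd X (dot n) (fconst X (-1))"
  have uv: "u \<in> A" "v \<in> A"
    by (simp_all add: u_def v_def fadd_in_A fmult_in_A fconst_in_A q dot_in_A)
  have "cmod (\<phi> (fmult X u v)) \<le> e"
    using n e by (intro char_norm_le[OF phi fmult_in_A[OF uv]]) (auto simp: u_def v_def norm_mult)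
  then show "cmod (1 - \<phi> q) * cmod (\<phi> (dot n) - 1) \<le> e"
    using phi uv
    by (simp add: char_fmult norm_mult)
      (simp add: u_def v_def char_fadd char_fmult char_fconst fadd_in_A fmult_in_A fconst_in_A q dot_in_A)
qed

definition N where "N n = tuple_norm (map G (K n))"

lemma N_nonneg: "N n \<phi> \<ge> 0"
  by (simp add: N_def)

lemma N_pt_eval: "x \<in> topspace X \<Longrightarrow> N n (pt_eval A x) = tuple_norm (K n) x"
  by (simp add: N_def tuple_norm_pt_eval R_witness_K[OF W])

text \<open>Bounding with \<open>f\<close> instead of the norm of \<open>K n\<close> makes the
  result independent of \<open>n\<close>, so it passes to the supremum \<open>g\<close>.\<close>

lemma char_mult_N_le:
  assumes "\<phi> \<in> \<Phi>" "a \<in> A" "C \<ge> 0"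
    and le: "\<And>x. x \<in> topspace X \<Longrightarrow> cmod (a x) * Re (f x) \<le> C"
  shows "cmod (\<phi> a) * N n \<phi> \<le> C"
  unfolding N_def using assms(1,2) R_witness_K[OF W] assms(3)
proof (rule char_mult_tuple_norm_le)
  fix x assume x: "x \<in> topspace X"
  have "cmod (a x) * tuple_norm (K n) x \<le> cmod (a x) * Re (f x)"
    by (intro mult_left_mono R_witness_lower[OF W x]) simp
  with le[OF x] show "cmod (a x) * tuple_norm (K n) x \<le> C" by simp
qed

lemma N_le_B: "\<phi> \<in> \<Phi> \<Longrightarrow> N n \<phi> \<le> B"
  using char_mult_N_le[of \<phi> "fconst X 1" B n] B_nonneg f_le_B by (simp add: fconst_in_A char_fconst)

text \<open>The sequence \<open>N n\<close> converges to \<open>g\<close> off the peak set; taking the supremum also covers the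
  peak set, where all its members vanish.\<close>

definition g where "g \<phi> = (SUP n. N n \<phi>)"

lemma N_le_g: "\<phi> \<in> \<Phi> \<Longrightarrow> N n \<phi> \<le> g \<phi>"
  unfolding g_def by (intro cSUP_upper bdd_aboveI2[of _ _ B] N_le_B) auto

lemma g_le: "(\<And>n. N n \<phi> \<le> C) \<Longrightarrow> g \<phi> \<le> C"
  unfolding g_def by (intro cSUP_least) auto

lemma g_nonneg: "\<phi> \<in> \<Phi> \<Longrightarrow> g \<phi> \<ge> 0"
  using N_le_g[of \<phi> 0] N_nonneg[of 0 \<phi>] by linarith

lemma g_le_B: "\<phi> \<in> \<Phi> \<Longrightarrow> g \<phi> \<le> B"
  by (intro g_le N_le_B)

lemma mult_g_le:
  assumes c: "c \<ge> 0" and C: "C \<ge> 0" and le: "\<And>n. c * N n \<phi> \<le> C"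
  shows "c * g \<phi> \<le> C"
proof (cases "c = 0")
  case False
  then have "g \<phi> \<le> C / c"
    using le c by (intro g_le) (simp add: field_simps)
  with False c show ?thesis
    by (simp add: field_simps)
qed (use C in simp)

text \<open>On \<open>X\<close> the bound holds for tuples with different indices \<open>n\<close>
  and \<open>m\<close>, so after transfer the supremum over \<open>m\<close> can be taken with
  \<open>n\<close> fixed.\<close>

lemma g_upper:
  assumes phi: "\<phi> \<in> \<Phi>"
  shows "tuple_norm (map G (H n)) \<phi> * g \<phi> \<le> 1"
proof (rule mult_g_le)
  show "tuple_norm (map G (H n)) \<phi> * N m \<phi> \<le> 1" for m
    unfolding N_def
  proof (rule tuple_norm_mult_le[OF phi R_witness_H[OF W] R_witness_K[OF W]])
    fix x assume x: "x \<in> topspace X"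
    have "tuple_norm (H n) x * tuple_norm (K m) x \<le> tuple_norm (H n) x * Re (f x)"
      by (intro mult_left_mono R_witness_lower[OF W x]) simp
    also have "\<dots> \<le> 1"
      using R_witness_upper[OF W x] by (simp add: mult.commute)
    finally show "tuple_norm (H n) x * tuple_norm (K m) x \<le> 1" .
  qed simp
qed auto

text \<open>By Cauchy-Schwarz and \<open>g_upper\<close>, \<open>g\<close> times the modulus of
  \<open>\<phi> (dot n)\<close> is at most \<open>N n\<close>. The defect is therefore controlled by
  the distance of \<open>\<phi> (dot n)\<close> from 1.\<close>

lemma g_minus_N_le:
  assumes phi: "\<phi> \<in> \<Phi>"
  shows "\<bar>g \<phi> - N n \<phi>\<bar> \<le> B * cmod (\<phi> (dot n) - 1)"
proof -
  have "cmod (\<phi> (dot n)) * g \<phi> \<le> tuple_norm (map G (H n)) \<phi> * N n \<phi> * g \<phi>"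
    unfolding char_dot[OF phi, symmetric] N_def
    by (intro mult_right_mono norm_tuple_dot_le g_nonneg phi) (simp add: R_witness_length[OF W])
  also have "\<dots> = (tuple_norm (map G (H n)) \<phi> * g \<phi>) * N n \<phi>"
    by simp
  also have "\<dots> \<le> N n \<phi>"
    using mult_right_mono[OF g_upper[OF phi] N_nonneg] by simp
  finally have "g \<phi> - N n \<phi> \<le> (1 - cmod (\<phi> (dot n))) * g \<phi>"
    by (simp add: algebra_simps)
  also have "\<dots> \<le> cmod (\<phi> (dot n) - 1) * g \<phi>"
    using norm_triangle_ineq2[of 1 "\<phi> (dot n)"]
    by (intro mult_right_mono g_nonneg phi) (simp add: norm_minus_commute)
  also have "\<dots> \<le> cmod (\<phi> (dot n) - 1) * B"
    by (intro mult_left_mono g_le_B phi) simp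
  finally show ?thesis
    using N_le_g[OF phi, of n] by (simp add: mult.commute)
qed

text \<open>The power found on \<open>X\<close> serves every \<open>N n\<close> at every character,
  hence also their supremum.\<close>

lemma power_mult_g_small:
  assumes e: "e > 0"
  shows "\<exists>j. \<forall>\<phi>\<in>\<Phi>. cmod (\<phi> q) ^ j * g \<phi> \<le> e"
proof -
  obtain j where j: "\<And>x. x \<in> topspace X \<Longrightarrow> cmod (q x) ^ j * Re (f x) \<le> e"
    using power_mult_f_small[OF e] by blast
  obtain b where b: "b \<in> A" "\<And>x. x \<in> topspace X \<Longrightarrow> b x = q x ^ j"
    "\<And>\<phi>. \<phi> \<in> \<Phi> \<Longrightarrow> \<phi> b = \<phi> q ^ j"
    using power_in_A[OF q] by blast
  have "cmod (\<phi> q) ^ j * g \<phi> \<le> e" if phi: "\<phi> \<in> \<Phi>" for \<phi>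
  proof (rule mult_g_le)
    fix n
    have "cmod (\<phi> b) * N n \<phi> \<le> e"
      using e j by (intro char_mult_N_le[OF phi b(1)]) (simp_all add: b(2) norm_power)
    then show "cmod (\<phi> q) ^ j * N n \<phi> \<le> e"
      by (simp add: b(3)[OF phi] norm_power)
  qed (use e in auto)
  then show ?thesis by blast
qed

definition ft where "ft = (\<lambda>\<phi>\<in>topspace M. complex_of_real (g \<phi>))"

lemma ft_apply: "\<phi> \<in> \<Phi> \<Longrightarrow> ft \<phi> = complex_of_real (g \<phi>)"
  by (simp add: ft_def)

text \<open>The approximants are \<open>\<bar>1 - q\<^sup>j\<bar> N n\<close>: the factor vanishes at the peak set, near which
  \<open>N n\<close> need not be close to \<open>g\<close>.\<close>

lemma ft_in_C_space: "ft \<in> mspace (C_space M)"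
proof -
  \<comment> \<open>Taking the closure of the whole space reduces continuity of \<open>ft\<close> to
    uniform approximation by continuous functions.\<close>
  have "ft \<in> mtopology_of (C_space M) closure_of mspace (C_space M)"
    unfolding C_closure_iff[OF order_refl]
  proof (intro conjI allI impI)
    show "ft \<in> extensional (topspace M)"
      by (simp add: ft_def)
    fix e :: real assume e: "e > 0"
    then obtain j where j: "\<And>\<phi>. \<phi> \<in> \<Phi> \<Longrightarrow> cmod (\<phi> q) ^ j * g \<phi> \<le> e / 2"
      using power_mult_g_small[of "e / 2"] by auto
    \<comment> \<open>The summand 1 avoids division by 0 when \<open>j\<close> or \<open>B\<close>
      vanishes.\<close>
    define e' where "e' = e / 2 / (real j * B + 1)"
    have jB: "real j * B \<ge> 0"
      using B_nonneg by simp
    then have e': "e' > 0" and je': "real j * B * e' \<le> e / 2"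
      using e by (auto simp: e'_def field_simps)
    obtain n where n: "\<And>\<phi>. \<phi> \<in> \<Phi> \<Longrightarrow> cmod (1 - \<phi> q) * cmod (\<phi> (dot n) - 1) \<le> e'"
      using eventually_happens'[OF sequentially_bot dot_limit[OF e']] by blast
    obtain b where b: "b \<in> A" "\<And>\<phi>. \<phi> \<in> \<Phi> \<Longrightarrow> \<phi> b = \<phi> q ^ j"
      using power_in_A[OF q] by blast
    define h where "h = (\<lambda>\<phi>\<in>topspace M. complex_of_real (cmod (1 - \<phi> b) * N n \<phi>))"
    have "continuous_map M euclidean (\<lambda>\<phi>. cmod (1 - \<phi> b) * N n \<phi>)"
      unfolding N_def using R_witness_K[OF W] b
      by (intro continuous_map_real_mult continuous_map_norm continuous_map_diff
          continuous_map_eval continuous_tuple_norm_gelfand) auto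
    then have "continuous_map M euclidean (\<lambda>\<phi>. complex_of_real (cmod (1 - \<phi> b) * N n \<phi>))"
      by (auto simp only: continuous_map_atin limitin_canonical_iff intro: tendsto_of_real)
    then have "continuous_map M euclidean h"
      by (rule continuous_map_eq) (simp add: h_def)
    moreover have "cmod (h \<phi>) \<le> 2 * B" if "\<phi> \<in> \<Phi>" for \<phi>
    proof -
      have "cmod (1 - \<phi> q ^ j) \<le> 1 + cmod (\<phi> q) ^ j"
        using norm_triangle_ineq4[of 1 "\<phi> q ^ j"] by (simp add: norm_power)
      also have "\<dots> \<le> 2"
        using char_q_le[OF that] by (simp add: power_le_one)
      finally show ?thesis
        using that N_le_B[OF that, of n] N_nonneg[of n \<phi>] b
        by (auto simp: h_def norm_mult intro!: mult_mono)
    qed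
    ultimately have "h \<in> mspace (C_space M)"
      unfolding mem_C_space_iff by (auto simp: h_def)
    moreover have "cmod (h \<phi> - ft \<phi>) \<le> e" if phi: "\<phi> \<in> topspace M" for \<phi>
    proof -
      have phi': "\<phi> \<in> \<Phi>" using phi by simp
      define c where "c = cmod (1 - \<phi> q ^ j)"
      have "cmod (h \<phi> - ft \<phi>) = \<bar>c * N n \<phi> - g \<phi>\<bar>"
        using phi b(2)[OF phi'] by (simp add: h_def ft_def c_def flip: of_real_mult of_real_diff)
      \<comment> \<open>The first term is handled by convergence of \<open>N n\<close> weighted by
        \<open>1 - q\<close>, the second by smallness of the \<open>j\<close>-th power of
        \<open>q\<close> times \<open>g\<close>.\<close>
      also have "\<dots> = \<bar>c * (N n \<phi> - g \<phi>) + (c - 1) * g \<phi>\<bar>"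
        by (simp add: algebra_simps)
      also have "\<dots> \<le> c * \<bar>g \<phi> - N n \<phi>\<bar> + \<bar>c - 1\<bar> * g \<phi>"
        using g_nonneg[OF phi']
        by (intro order_trans[OF abs_triangle_ineq]) (simp add: abs_mult c_def abs_minus_commute)
      \<comment> \<open>As \<open>\<phi> q\<close> lies in the unit disc, \<open>c\<close> is at
        most \<open>j\<close> times \<open>cmod (1 - \<phi> q)\<close>, which supplies the factor
        required by \<open>dot_limit\<close>.\<close>
      also have "c * \<bar>g \<phi> - N n \<phi>\<bar> \<le>
          (real j * cmod (1 - \<phi> q)) * (B * cmod (\<phi> (dot n) - 1))"
        using norm_power_diff[of 1 "\<phi> q" j] char_q_le[OF phi'] g_minus_N_le[OF phi', of n]
        by (intro mult_mono) (auto simp: c_def)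
      also have "\<dots> = real j * B * (cmod (1 - \<phi> q) * cmod (\<phi> (dot n) - 1))"
        by simp
      also have "\<dots> \<le> real j * B * e'"
        using n[OF phi'] jB by (rule mult_left_mono)
      also have "\<bar>c - 1\<bar> * g \<phi> \<le> cmod (\<phi> q) ^ j * g \<phi>"
      proof (rule mult_right_mono[OF _ g_nonneg[OF phi']])
        show "\<bar>c - 1\<bar> \<le> cmod (\<phi> q) ^ j"
          using norm_triangle_ineq3[of "1 - \<phi> q ^ j" 1] by (simp add: c_def norm_power)
      qed
      finally show ?thesis
        using j[OF phi'] je' by linarith
    qed
    ultimately show "\<exists>s\<in>mspace (C_space M). \<forall>\<phi>\<in>topspace M. cmod (s \<phi> - ft \<phi>) \<le> e"
      by blast
  qed
  then show ?thesis
    using C_closure_subset by blast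
qed

text \<open>If \<open>\<phi> q = 1\<close>, the powers of \<open>q\<close> have no effect and
  \<open>power_mult_g_small\<close> makes \<open>g\<close> arbitrarily small. If \<open>g\<close>
  vanishes, then so does every \<open>\<phi> (dot n)\<close>, and \<open>dot_limit\<close> leaves
  only \<open>1 - \<phi> q\<close>, which must be 0.\<close>

lemma ft_eq_0_iff:
  assumes phi: "\<phi> \<in> \<Phi>"
  shows "ft \<phi> = 0 \<longleftrightarrow> \<phi> q = 1"
proof
  assume q1: "\<phi> q = 1"
  have "g \<phi> \<le> 0"
  proof (rule field_le_epsilon)
    fix e :: real assume "e > 0"
    then show "g \<phi> \<le> 0 + e"
      using power_mult_g_small[of e] phi q1 by force
  qed
  with g_nonneg[OF phi] show "ft \<phi> = 0"
    by (simp add: ft_apply phi)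
next
  assume "ft \<phi> = 0"
  then have "g \<phi> = 0"
    by (simp add: ft_apply phi)
  then have "N n \<phi> = 0" for n
    using N_le_g[OF phi, of n] N_nonneg[of n \<phi>] by simp
  then have "\<phi> (dot n) = 0" for n
    using norm_tuple_dot_le[of "map G (H n)" "map G (K n)" \<phi>]
    by (simp add: char_dot[OF phi] R_witness_length[OF W] N_def)
  then have "cmod (1 - \<phi> q) \<le> e" if "e > 0" for e
    using eventually_happens'[OF sequentially_bot dot_limit[OF that]] phi by auto
  then have "cmod (1 - \<phi> q) \<le> 0"
    by (rule field_le_epsilon) simp
  then show "\<phi> q = 1" by simp
qed

text \<open>The Gelfand transforms of the original tuples are the witnesses. On a compact set off
  the peak set \<open>cmod (1 - \<phi> q)\<close> has a positive minimum, so this weight can be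
  divided out of \<open>dot_limit\<close>.\<close>

lemma ft_in_R_class: "ft \<in> R_class M (G ` A) {\<phi> \<in> \<Phi>. \<phi> q = 1}"
  unfolding R_class_iff
proof (intro conjI exI)
  show "ft \<in> mspace (C_space M)" by (rule ft_in_C_space)
  show "{\<phi> \<in> topspace M. ft \<phi> = 0} = {\<phi> \<in> \<Phi>. \<phi> q = 1}"
    using ft_eq_0_iff by auto
  show "R_witness M (G ` A) {\<phi> \<in> \<Phi>. \<phi> q = 1} ft (\<lambda>n. map G (H n)) (\<lambda>n. map G (K n))"
    unfolding R_witness_def
  proof (intro conjI allI ballI impI)
    fix n
    show "set (map G (H n)) \<subseteq> G ` A" "set (map G (K n)) \<subseteq> G ` A"
      using R_witness_H[OF W, of n] R_witness_K[OF W, of n] by auto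
    show "length (map G (H n)) = length (map G (K n))"
      by (simp add: R_witness_length[OF W])
    fix \<phi> assume "\<phi> \<in> topspace M"
    then have phi: "\<phi> \<in> \<Phi>" by simp
    show "ft \<phi> \<in> \<real>" by (simp add: ft_apply phi)
    show "tuple_norm (map G (K n)) \<phi> \<le> Re (ft \<phi>)"
      using N_le_g[OF phi, of n] by (simp add: ft_apply phi N_def)
    show "Re (ft \<phi>) * tuple_norm (map G (H n)) \<phi> \<le> 1"
      using g_upper[OF phi, of n] by (simp add: ft_apply phi mult.commute)
  next
    fix S assume S: "compactin M S \<and> S \<subseteq> topspace M - {\<phi> \<in> \<Phi>. \<phi> q = 1}"
    show "uniform_limit S (\<lambda>n \<phi>. tuple_dot (map G (H n)) (map G (K n)) \<phi>) (\<lambda>_. 1) sequentially"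
    proof (cases "S = {}")
      case False
      have "continuous_map M euclidean (\<lambda>\<phi>. - cmod (1 - \<phi> q))"
        by (intro continuous_map_minus continuous_map_norm continuous_map_diff continuous_map_eval q) auto
      then obtain \<psi> where psi: "\<psi> \<in> S" and min: "\<And>\<phi>. \<phi> \<in> S \<Longrightarrow> cmod (1 - \<psi> q) \<le> cmod (1 - \<phi> q)"
        using attains_max_on_closed[of M S "\<lambda>\<phi>. - cmod (1 - \<phi> q)"] S False by auto
      define d where "d = cmod (1 - \<psi> q)"
      have d: "d > 0"
        using S psi by (auto simp: d_def)
      show ?thesis
        unfolding uniform_limit_iff
      proof (intro allI impI)
        fix e :: real assume e: "e > 0"
        \<comment> \<open>Division by \<open>d\<close> leaves \<open>e / 2\<close>, which turns the
          weak bound into the strict one required.\<close>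
        then have "d * (e / 2) > 0" using d by simp
        from dot_limit[OF this]
        show "\<forall>\<^sub>F n in sequentially. \<forall>\<phi>\<in>S. dist (tuple_dot (map G (H n)) (map G (K n)) \<phi>) 1 < e"
        proof (rule eventually_mono, intro ballI)
          fix n \<phi> assume n: "\<forall>\<phi>\<in>\<Phi>. cmod (1 - \<phi> q) * cmod (\<phi> (dot n) - 1) \<le> d * (e / 2)"
            and "\<phi> \<in> S"
          then have phi: "\<phi> \<in> \<Phi>" and "d \<le> cmod (1 - \<phi> q)"
            using S min by (auto simp: d_def)
          then have "d * cmod (\<phi> (dot n) - 1) \<le> d * (e / 2)"
            using bspec[OF n phi] by (meson mult_right_mono norm_ge_zero order_trans)
          then have "cmod (\<phi> (dot n) - 1) \<le> e / 2"
            using d by simp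
          then show "dist (tuple_dot (map G (H n)) (map G (K n)) \<phi>) 1 < e"
            using e by (simp add: char_dot[OF phi] dist_norm)
        qed
      qed
    qed simp
  qed
qed

text \<open>On \<open>E\<close> both sides vanish. Off \<open>E\<close> the norms of
  \<open>K n\<close> are bounded by \<open>f\<close> and converge to it, so their supremum is
  \<open>f\<close>.\<close>

lemma ft_pt_eval:
  assumes x: "x \<in> topspace X"
  shows "ft (pt_eval A x) = f x"
proof (cases "x \<in> E")
  case True
  then have "f x = 0" "q x = 1"
    using zeros q_E by auto
  then show ?thesis
    using ft_eq_0_iff[OF pt_eval_in_characters[OF x]] q by simp
next
  case False
  note phi = pt_eval_in_characters[OF x]
  have "g (pt_eval A x) \<le> Re (f x)"
    using R_witness_lower[OF W x] by (intro g_le) (simp add: N_pt_eval x)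
  moreover have "Re (f x) \<le> g (pt_eval A x)"
    using N_le_g[OF phi] R_witness_norm_limit[OF W x False]
    by (intro LIMSEQ_le_const2) (auto simp: N_pt_eval x)
  ultimately show ?thesis
    using R_witness_Reals[OF W x] by (auto simp: ft_apply phi elim!: Reals_cases)
qed

end

section \<open>Peak sets, norm equality and the module isometry\<close>

context uniform_alg
begin

text \<open>A peak function for \<open>D\<close> is the Gelfand transform of some \<open>q\<close>.
  Since \<open>A\<close> separates points, point evaluation is injective, so this one
  \<open>q\<close> also peaks exactly on \<open>E\<close>.\<close>

lemma peak_set_gelfandE:
  assumes D: "peak_set M (G ` A) D" and E: "E \<subseteq> topspace X"
    and DE: "D \<inter> pt_eval A ` topspace X = pt_eval A ` E"
  obtains q where "q \<in> A" "D = {\<phi> \<in> \<Phi>. \<phi> q = 1}" "E = {x \<in> topspace X. q x = 1}"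
    "\<And>x. x \<in> topspace X - E \<Longrightarrow> cmod (q x) < 1"
proof -
  obtain q where q: "q \<in> A" and "D = {\<phi> \<in> topspace M. G q \<phi> = 1}"
    and less: "\<forall>\<phi>\<in>topspace M - D. cmod (G q \<phi>) < 1"
    using D unfolding peak_set_def by blast
  then have D_eq: "D = {\<phi> \<in> \<Phi>. \<phi> q = 1}"
    by auto
  have iff: "pt_eval A x \<in> D \<longleftrightarrow> x \<in> E" if x: "x \<in> topspace X" for x
  proof
    assume "pt_eval A x \<in> D"
    then obtain y where y: "y \<in> E" "pt_eval A x = pt_eval A y"
      using x DE by blast
    then have "\<forall>a\<in>A. a x = a y"
      by (metis pt_eval_apply)
    then have "x = y"
      using separates[OF x] y E by blast
    then show "x \<in> E" using y by simp
  qed (use DE in blast)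
  show thesis
  proof (rule that[OF q D_eq])
    show "E = {x \<in> topspace X. q x = 1}"
      using iff E q by (auto simp: D_eq pt_eval_in_characters)
    fix x assume "x \<in> topspace X - E"
    then show "cmod (q x) < 1"
      using iff[of x] bspec[OF less, of "pt_eval A x"] q by (simp add: pt_eval_in_characters)
  qed
qed

lemma pullback_gelfand:
  "a \<in> A \<Longrightarrow> pullback X (pt_eval A) (G a) = a"
  using extensional_A[of a]
  by (auto simp: pullback_def fun_eq_iff pt_eval_in_characters extensional_def)

text \<open>Bounds go up to the maximal ideal space by \<open>R_class_gelfand_bound\<close> and come
  down by restriction to point evaluations.\<close>

lemma sup_norm_fmult_gelfand:
  assumes ft: "ft \<in> R_class M (G ` A) D" and f: "f \<in> mspace (C_space X)"
    and eq: "\<And>x. x \<in> topspace X \<Longrightarrow> ft (pt_eval A x) = f x" and a: "a \<in> A"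
  shows "sup_norm X (fmult X a f) = sup_norm M (fmult M (G a) ft)"
proof (rule sup_norm_eqI)
  show "fmult X a f \<in> mspace (C_space X)"
    by (intro fmult_in_C_space A_C a f)
  have "ft \<in> mspace (C_space M)"
    using ft unfolding R_class_iff by blast
  then show "fmult M (G a) ft \<in> mspace (C_space M)"
    by (intro fmult_in_C_space gelfand_in_C_space a)
  fix e :: real assume e: "e \<ge> 0"
  show "(\<forall>x\<in>topspace X. cmod (fmult X a f x) \<le> e) \<longleftrightarrow> (\<forall>y\<in>topspace M. cmod (fmult M (G a) ft y) \<le> e)"
  proof safe
    fix \<phi> assume le: "\<forall>x\<in>topspace X. cmod (fmult X a f x) \<le> e" and phi: "\<phi> \<in> topspace M"
    then show "cmod (fmult M (G a) ft \<phi>) \<le> e"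
      using R_class_gelfand_bound[OF ft a e, of \<phi>] by (simp add: eq)
  next
    fix x assume le: "\<forall>y\<in>topspace M. cmod (fmult M (G a) ft y) \<le> e" and x: "x \<in> topspace X"
    then show "cmod (fmult X a f x) \<le> e"
      using bspec[OF le, of "pt_eval A x"] a by (simp add: pt_eval_in_characters eq)
  qed
qed

text \<open>Restriction \<open>R\<close> to the original space preserves bounds on differences, so
  it is injective on the closed module \<open>Q\<close> and maps it onto the other one. The required
  isometry is its inverse.\<close>

lemma A_isometric_cyclic_module_gelfand:
  assumes ft: "ft \<in> R_class M (G ` A) D" and f: "f \<in> mspace (C_space X)"
    and eq: "\<And>x. x \<in> topspace X \<Longrightarrow> ft (pt_eval A x) = f x"
  shows "A_isometric A X (\<lambda>a. a) (cyclic_module X A (\<lambda>a. a) f) M G (cyclic_module M A G ft)"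
proof -
  define R where "R = pullback X (pt_eval A)"
  define S where "S = (\<lambda>a. fmult M (G a) ft) ` A"
  define Q where "Q = mtopology_of (C_space M) closure_of S"
  have ft_C: "ft \<in> mspace (C_space M)"
    using ft unfolding R_class_iff by blast
  have S: "S \<subseteq> mspace (C_space M)"
    unfolding S_def by (auto intro!: fmult_in_C_space gelfand_in_C_space ft_C simp del: mspace_cfunspace)
  have f_eq: "R ft = f"
    using f eq by (auto simp: R_def pullback_def mem_C_space_iff fun_eq_iff extensional_def)
  have RS: "R ` S = (\<lambda>a. fmult X a f) ` A"
    unfolding S_def image_image R_def
    by (auto simp: pullback_fmult[OF continuous_pt_eval] pullback_gelfand f_eq[unfolded R_def])
  \<comment> \<open>A difference of two generators is \<open>c\<close> times \<open>ft\<close> with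
    \<open>c\<close> in \<open>A\<close>, so \<open>R_class_gelfand_bound\<close> applies to
    it.\<close>
  have iso: "\<forall>\<phi>\<in>topspace M. cmod (s \<phi> - t \<phi>) \<le> e"
    if "s \<in> S" "t \<in> S" and le: "\<forall>x\<in>topspace X. cmod (s (pt_eval A x) - t (pt_eval A x)) \<le> e" and e: "e \<ge> 0"
    for s t e
  proof
    fix \<phi> assume phi: "\<phi> \<in> topspace M"
    from that obtain a b where a: "a \<in> A" "s = fmult M (G a) ft" and b: "b \<in> A" "t = fmult M (G b) ft"
      by (auto simp: S_def)
    define c where "c = fadd X a (fmult X (fconst X (-1)) b)"
    have c: "c \<in> A"
      by (simp add: c_def fadd_in_A fmult_in_A fconst_in_A a b)
    have "\<phi> c = \<phi> a - \<phi> b"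
      using phi a b by (simp add: c_def char_fadd char_fmult char_fconst fmult_in_A fconst_in_A)
    moreover have "cmod (\<phi> c * ft \<phi>) \<le> e"
    proof (rule R_class_gelfand_bound[OF ft c e])
      fix x assume x: "x \<in> topspace X"
      have "s (pt_eval A x) - t (pt_eval A x) = c x * ft (pt_eval A x)"
        using x a b by (simp add: pt_eval_in_characters c_def algebra_simps)
      then show "cmod (c x * ft (pt_eval A x)) \<le> e"
        using bspec[OF le x] by simp
    qed (use phi in simp)
    ultimately show "cmod (s \<phi> - t \<phi>) \<le> e"
      using phi a b by (simp add: left_diff_distrib)
  qed
  have image: "R ` Q = cyclic_module X A (\<lambda>a. a) f"
    unfolding cyclic_module_def RS[symmetric] R_def Q_def
    using pullback_closure_image[OF S continuous_pt_eval iso] .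
  have Q_C: "Q \<subseteq> mspace (C_space M)"
    unfolding Q_def by (rule C_closure_subset[OF S])
  have norm: "cmod (x \<phi> - y \<phi>) \<le> e"
    if "x \<in> Q" "y \<in> Q" "\<forall>w\<in>topspace X. cmod (R x w - R y w) \<le> e" "e \<ge> 0" "\<phi> \<in> topspace M"
    for x y e \<phi>
  proof (rule pullback_closure_norm[OF S continuous_pt_eval, where f = x and g = y and y = \<phi> and e = e])
    show "\<forall>\<phi>\<in>topspace M. cmod (s \<phi> - t \<phi>) \<le> e'"
      if "s \<in> S" "t \<in> S" "\<forall>x\<in>topspace X. cmod (s (pt_eval A x) - t (pt_eval A x)) \<le> e'" "e' \<ge> 0"
      for s t e'
      by (rule iso[OF that])
    show "\<forall>w\<in>topspace X. cmod (x (pt_eval A w) - y (pt_eval A w)) \<le> e"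
      using that(3) by (simp add: R_def pullback_def)
  qed (use that in \<open>simp_all only: Q_def\<close>)
  have inj: "inj_on R Q"
  proof (rule inj_onI)
    fix x y assume xy: "x \<in> Q" "y \<in> Q" "R x = R y"
    then have "x \<phi> = y \<phi>" if "\<phi> \<in> topspace M" for \<phi>
      using norm[of x y 0 \<phi>] that by simp
    moreover have "x \<in> extensional (topspace M)" "y \<in> extensional (topspace M)"
      using xy Q_C by (auto simp: mem_C_space_iff)
    ultimately show "x = y"
      by (metis extensionalityI)
  qed
  \<comment> \<open>Closure of \<open>Q\<close> under the module operations is what allows the
    inverse of \<open>R\<close> to be evaluated on sums and products.\<close>
  have add: "fadd M x y \<in> Q" if "x \<in> Q" "y \<in> Q" for x y
    unfolding Q_def
  proof (rule C_closure_fadd[OF S])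
    fix s t assume "s \<in> S" "t \<in> S"
    then obtain a b where "a \<in> A" "s = fmult M (G a) ft" "b \<in> A" "t = fmult M (G b) ft"
      by (auto simp: S_def)
    then have "fadd M s t = fmult M (G (fadd X a b)) ft" "fadd X a b \<in> A"
      by (auto simp: fadd_in_A fadd_def[of M] fmult_def[of M] char_fadd algebra_simps)
    then show "fadd M s t \<in> S"
      unfolding S_def by blast
  qed (use that in \<open>simp_all add: Q_def\<close>)
  have mult: "fmult M (G a) x \<in> Q" if a: "a \<in> A" and "x \<in> Q" for a x
    unfolding Q_def
  proof (rule C_closure_fmult[OF S _ gelfand_in_C_space[OF a]])
    fix s assume "s \<in> S"
    then obtain b where "b \<in> A" "s = fmult M (G b) ft"
      by (auto simp: S_def)
    with a have "fmult M (G a) s = fmult M (G (fmult X a b)) ft" "fmult X a b \<in> A"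
      by (auto simp: fmult_in_A fmult_def[of M] char_fmult)
    then show "fmult M (G a) s \<in> S"
      unfolding S_def by blast
  qed (use that in \<open>simp_all add: Q_def\<close>)
  \<comment> \<open>Comparison with the zero function turns the bound for differences into one for
    single elements.\<close>
  have zero: "(\<lambda>\<phi>\<in>topspace M. 0) \<in> Q"
  proof -
    have "fmult M (G (fconst X 0)) ft = (\<lambda>\<phi>\<in>topspace M. 0)"
      by (auto simp: fmult_def[of M] char_fconst)
    then have "(\<lambda>\<phi>\<in>topspace M. 0) \<in> S"
      unfolding S_def using fconst_in_A[of 0] by (metis imageI)
    then show ?thesis
      unfolding Q_def using closure_of_subset[of S "mtopology_of (C_space M)"] S
      by (auto simp del: mspace_cfunspace)
  qed
  have sup: "sup_norm X (R x) = sup_norm M x" if x: "x \<in> Q" for x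
  proof (rule sup_norm_eqI)
    show x_C: "x \<in> mspace (C_space M)"
      using x Q_C by blast
    show "R x \<in> mspace (C_space X)"
      unfolding R_def by (rule pullback_in_C_space[OF continuous_pt_eval x_C])
    fix e :: real assume e: "e \<ge> 0"
    show "(\<forall>w\<in>topspace X. cmod (R x w) \<le> e) \<longleftrightarrow> (\<forall>\<phi>\<in>topspace M. cmod (x \<phi>) \<le> e)"
    proof safe
      fix \<phi> assume "\<forall>w\<in>topspace X. cmod (R x w) \<le> e" and phi: "\<phi> \<in> topspace M"
      then show "cmod (x \<phi>) \<le> e"
        using norm[OF x zero _ e phi] by (simp add: R_def pullback_def pt_eval_in_characters)
    qed (simp add: R_def pullback_def pt_eval_in_characters)
  qed
  define T where "T = inv_into Q R"
  have TR: "T (R x) = x" if "x \<in> Q" for x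
    using inj that by (simp add: T_def)
  have "T ` R ` Q = Q"
    using TR by force
  moreover have "T (fadd X (R x) (R y)) = fadd M x y" if "x \<in> Q" "y \<in> Q" for x y
    using TR[OF add[OF that]] by (simp add: R_def pullback_fadd[OF continuous_pt_eval])
  moreover have "T (fmult X a (R x)) = fmult M (G a) x" if "a \<in> A" "x \<in> Q" for a x
    using TR[OF mult[OF that]] that(1)
    by (simp add: R_def pullback_fmult[OF continuous_pt_eval] pullback_gelfand)
  ultimately have "A_isometric A X (\<lambda>a. a) (R ` Q) M G Q"
    unfolding A_isometric_def by (intro exI[of _ T]) (auto simp: TR sup)
  moreover have "cyclic_module M A G ft = Q"
    by (simp add: cyclic_module_def Q_def S_def)
  ultimately show ?thesis
    by (simp only: image)
qed

end

theorem theorem8p13: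
  fixes \<Omega> :: "'x topology"
    and A :: "('x \<Rightarrow> complex) set"
    and E :: "'x set"
    and f :: "'x \<Rightarrow> complex"
    and D :: "(('x \<Rightarrow> complex) \<Rightarrow> complex) set"
  assumes "uniform_algebra \<Omega> A"
    and "peak_set \<Omega> A E"
    and "f \<in> R_class \<Omega> A E"
    and "peak_set (max_ideal_space \<Omega> A) (gelfand \<Omega> A ` A) D"
    and "D \<inter> pt_eval A ` topspace \<Omega> = pt_eval A ` E"
  shows "(\<exists>!ft. ft \<in> R_class (max_ideal_space \<Omega> A) (gelfand \<Omega> A ` A) D \<and>
                (\<forall>w\<in>topspace \<Omega>. ft (pt_eval A w) = f w)) \<and>
         (\<forall>ft. ft \<in> R_class (max_ideal_space \<Omega> A) (gelfand \<Omega> A ` A) D \<and>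
                (\<forall>w\<in>topspace \<Omega>. ft (pt_eval A w) = f w) \<longrightarrow>
            (\<forall>a\<in>A. sup_norm \<Omega> (fmult \<Omega> a f) =
                   sup_norm (max_ideal_space \<Omega> A)
                     (fmult (max_ideal_space \<Omega> A) (gelfand \<Omega> A a) ft)) \<and>
            A_isometric A
              \<Omega> (\<lambda>a. a) (cyclic_module \<Omega> A (\<lambda>a. a) f)
              (max_ideal_space \<Omega> A) (gelfand \<Omega> A)
                (cyclic_module (max_ideal_space \<Omega> A) A (gelfand \<Omega> A) ft))"
proof -
  interpret uniform_alg \<Omega> A
    by unfold_locales (rule assms(1))
  have f: "f \<in> mspace (C_space \<Omega>)" and zeros: "{w \<in> topspace \<Omega>. f w = 0} = E"
    and "\<exists>H K. R_witness \<Omega> A E f H K"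
    using assms(3) unfolding R_class_iff by blast+
  then obtain H K where W: "R_witness \<Omega> A E f H K"
    by blast
  have E: "E \<subseteq> topspace \<Omega>"
    using zeros by blast
  \<comment> \<open>A single \<open>q\<close> cuts out both \<open>E\<close> and \<open>D\<close>,
    so the zero set of the constructed \<open>ft\<close> is exactly the given
    \<open>D\<close>.\<close>
  obtain q where q: "q \<in> A" and D: "D = {\<phi> \<in> \<Phi>. \<phi> q = 1}" and "E = {x \<in> topspace \<Omega>. q x = 1}"
    "\<And>x. x \<in> topspace \<Omega> - E \<Longrightarrow> cmod (q x) < 1"
    using peak_set_gelfandE[OF assms(4) E assms(5)] by blast
  then interpret R_extension \<Omega> A E f H K q
    using f zeros W by unfold_locales
  show ?thesis
  proof (intro conjI allI impI ballI ex1I[of _ ft])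
    show "ft \<in> R_class M (G ` A) D"
      unfolding D by (rule ft_in_R_class)
    show "ft (pt_eval A w) = f w" if "w \<in> topspace \<Omega>" for w
      using that by (rule ft_pt_eval)
    fix h assume h: "h \<in> R_class M (G ` A) D \<and> (\<forall>w\<in>topspace \<Omega>. h (pt_eval A w) = f w)"
    show "h = ft"
      using h ft_pt_eval by (intro R_class_gelfand_unique[of h D]) (auto simp: D ft_in_R_class)
    show "sup_norm \<Omega> (fmult \<Omega> a f) = sup_norm M (fmult M (G a) h)" if "a \<in> A" for a
      using h that by (intro sup_norm_fmult_gelfand f) auto
    show "A_isometric A \<Omega> (\<lambda>a. a) (cyclic_module \<Omega> A (\<lambda>a. a) f) M G (cyclic_module M A G h)"
      using h by (intro A_isometric_cyclic_module_gelfand f) auto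
  qed
qed

end
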